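(* Consider an $n$-qubit noisy trajectory on a one-dimensional local circuit, $$\rho_\ell=\mathcal D_\lambda^{\otimes n}\circ\mathcal U_\ell(\rho_{\ell-1}),\qquad \rho_0=|0\rangle\langle 0|^{\otimes n},$$ where $\lambda\in(0,1)$ is a fixed depolarizing strength, $\mathcal U_\ell(\cdot)=U_\ell(\cdot)U_\ell^\dagger$, and each $U_\ell$ is a product of disjoint local gates (the gates of the $\ell$-th layer), each acting on at most $\kappa=O(1)$ consecutive qubits. Fix an arbitrary cut of the chain and a relative error tolerance $\varepsilon\in(0,1)$. Then there exists a sequential approximation $\{\widehat\rho_\ell\}$, with each $\widehat\rho_\ell$ having $\mathrm{poly}(n)$ bond dimension across the prescribed cut, such that, for every $\ell$, $$\|\rho_\ell-\widehat\rho_\ell\|_2^2\le\varepsilon\,\|\rho_\ell\|_2^2 .$$ In particular, since $\|\rho_\ell\|_2^2\le1$, the same construction also gives fixed absolute error $\|\rho_\ell-\widehat\rho_\ell\|_2^2\le\varepsilon$.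
   Context: $\mathcal D_\lambda$ is single-qubit depolarizing noise, $\mathcal D_\lambda(\sigma)=(1-\lambda)\sigma+\lambda\,\mathbb I/2$ on single-qubit states $\sigma$, extended linearly. $\|X\|_2=\sqrt{\mathrm{tr}(X^\dagger X)}$ is the Hilbert-Schmidt norm. A cut divides the chain into a left part $A$ and a right part $B$; the bond dimension of an operator $X$ across the cut is its operator Schmidt rank, i.e. the least $r$ with $X=\sum_{\alpha=1}^rX^A_\alpha\otimes X^B_\alpha$. "Sequential approximation" means a sequence of $n$-qubit operators $\widehat\rho_\ell$ indexed by the depth $\ell$, approximating the trajectory $\rho_\ell$. $\mathrm{poly}(n)$ means bounded by a polynomial in $n$, with $\lambda$, $\varepsilon$ and $\kappa$ held fixed. *)

theory Defs
  imports
    "HOL-Computational_Algebra.Polynomial"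
    "Jordan_Normal_Form.Schur_Decomposition"
begin

text \<open>
  Operators on \<open>n\<close> qubits are complex matrices in \<open>carrier_mat (2 ^ n) (2 ^ n)\<close>, with respect to
  the computational basis.  The leftmost qubit of the chain (number \<open>0\<close>) is the leftmost tensor
  factor.
\<close>

definition kron :: "complex mat \<Rightarrow> complex mat \<Rightarrow> complex mat" where
  "kron A B = mat (dim_row A * dim_row B) (dim_col A * dim_col B)
     (\<lambda>(i, j). A $$ (i div dim_row B, j div dim_col B) * B $$ (i mod dim_row B, j mod dim_col B))"

primrec kron_power :: "complex mat \<Rightarrow> nat \<Rightarrow> complex mat" where
  "kron_power A 0 = 1\<^sub>m 1"
| "kron_power A (Suc n) = kron A (kron_power A n)"

definition mat_trace :: "complex mat \<Rightarrow> complex" where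
  "mat_trace A = (\<Sum>i<dim_row A. A $$ (i, i))"

definition hs_norm :: "complex mat \<Rightarrow> real" where
  "hs_norm X = sqrt (Re (mat_trace (mat_adjoint X * X)))"

definition unitary_mat :: "nat \<Rightarrow> complex mat \<Rightarrow> bool" where
  "unitary_mat d U \<longleftrightarrow>
     U \<in> carrier_mat d d \<and> mat_adjoint U * U = 1\<^sub>m d \<and> U * mat_adjoint U = 1\<^sub>m d"

text \<open>
  The factor \<open>tr \<sigma>\<close> is the linear extension, from states to all single-qubit operators, of
  \<open>\<sigma> \<mapsto> (1 - lam) \<sigma> + lam I / 2\<close>.
\<close>

definition depolarizing :: "real \<Rightarrow> complex mat \<Rightarrow> complex mat" where
  "depolarizing lam \<sigma> =
     complex_of_real (1 - lam) \<cdot>\<^sub>m \<sigma> + (complex_of_real lam * mat_trace \<sigma> / 2) \<cdot>\<^sub>m 1\<^sub>m 2"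

definition qubit_unit :: "nat \<Rightarrow> nat \<Rightarrow> complex mat" where
  "qubit_unit a b = mat 2 2 (\<lambda>(i, j). if i = a \<and> j = b then 1 else 0)"

definition index_bit :: "nat \<Rightarrow> nat \<Rightarrow> nat" where
  "index_bit q k = k div 2 ^ q mod 2"

text \<open>
  The \<open>n\<close>-fold tensor power of a linear map \<open>\<Phi>\<close> on single-qubit operators: the linear map that
  sends the matrix unit with indices \<open>(k, l)\<close>, which is the tensor product over the qubits \<open>q\<close> of
  the matrix units \<open>qubit_unit (index_bit q k) (index_bit q l)\<close>, to the tensor product of
  their images under \<open>\<Phi>\<close>.  Here \<open>index_bit\<close> numbers the qubits from the right, which is
  immaterial because all tensor factors carry the same map.
\<close>

definition tensor_power_map ::
  "(complex mat \<Rightarrow> complex mat) \<Rightarrow> nat \<Rightarrow> complex mat \<Rightarrow> complex mat" where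
  "tensor_power_map \<Phi> n X = mat (2 ^ n) (2 ^ n) (\<lambda>(i, j).
     \<Sum>k<2 ^ n. \<Sum>l<2 ^ n. X $$ (k, l) *
       (\<Prod>q<n. \<Phi> (qubit_unit (index_bit q k) (index_bit q l)) $$ (index_bit q i, index_bit q j)))"

text \<open>
  A gate \<open>(a, k, G)\<close> is the operator \<open>G\<close> acting on the \<open>k\<close> consecutive qubits \<open>a, \<dots>, a + k - 1\<close>.
\<close>

type_synonym gate = "nat \<times> nat \<times> complex mat"

definition local_gate :: "nat \<Rightarrow> nat \<Rightarrow> gate \<Rightarrow> bool" where
  "local_gate kappa n = (\<lambda>(a, k, G). 1 \<le> k \<and> k \<le> kappa \<and> a + k \<le> n \<and> unitary_mat (2 ^ k) G)"

definition gate_support :: "gate \<Rightarrow> nat set" where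
  "gate_support = (\<lambda>(a, k, G). {a..<a + k})"

definition gate_op :: "nat \<Rightarrow> gate \<Rightarrow> complex mat" where
  "gate_op n = (\<lambda>(a, k, G). kron (1\<^sub>m (2 ^ a)) (kron G (1\<^sub>m (2 ^ (n - (a + k))))))"

definition local_layer :: "nat \<Rightarrow> nat \<Rightarrow> complex mat \<Rightarrow> bool" where
  "local_layer kappa n U \<longleftrightarrow> (\<exists>gs. (\<forall>g \<in> set gs. local_gate kappa n g)
     \<and> sorted_wrt (\<lambda>g h. gate_support g \<inter> gate_support h = {}) gs
     \<and> U = foldr (\<lambda>g M. gate_op n g * M) gs (1\<^sub>m (2 ^ n)))"

primrec trajectory :: "real \<Rightarrow> nat \<Rightarrow> (nat \<Rightarrow> complex mat) \<Rightarrow> nat \<Rightarrow> complex mat" where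
  "trajectory lam n U 0 = kron_power (qubit_unit 0 0) n"
| "trajectory lam n U (Suc l) = tensor_power_map (depolarizing lam) n
     (U (Suc l) * trajectory lam n U l * mat_adjoint (U (Suc l)))"

text \<open>
  The operator Schmidt rank of \<open>X\<close> across the cut between the first \<open>c\<close> qubits and the remaining
  \<open>n - c\<close> qubits.  For \<open>c \<le> n\<close> and \<open>X \<in> carrier_mat (2 ^ n) (2 ^ n)\<close> a decomposition always
  exists, so the minimum is attained.
\<close>

definition cut_decomposition :: "nat \<Rightarrow> nat \<Rightarrow> complex mat \<Rightarrow> nat \<Rightarrow> bool" where
  "cut_decomposition n c X r \<longleftrightarrow> (\<exists>XA XB.
     (\<forall>\<alpha><r. XA \<alpha> \<in> carrier_mat (2 ^ c) (2 ^ c) \<and>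
             XB \<alpha> \<in> carrier_mat (2 ^ (n - c)) (2 ^ (n - c))) \<and>
     X = mat (2 ^ n) (2 ^ n) (\<lambda>(i, j). \<Sum>\<alpha><r. kron (XA \<alpha>) (XB \<alpha>) $$ (i, j)))"

definition bond_dim :: "nat \<Rightarrow> nat \<Rightarrow> complex mat \<Rightarrow> nat" where
  "bond_dim n c X = (LEAST r. cut_decomposition n c X r)"

end

theory Submission
  imports Defs "HOL-Analysis.L2_Norm"
begin

text \<open>
  Let \<open>F\<close> be \<open>2\<^sup>n\<close> times the purity of the state.  One layer of noise maps \<open>F\<close> to at most
  \<open>F\<^sup>\<eta>\<close> for some \<open>\<eta> < 1\<close> depending only on the noise strength.  As \<open>F \<le> 2\<^sup>n\<close> initially, after
  \<open>O(log n)\<close> layers \<open>F \<le> 1 + \<epsilon>\<close>, and the maximally mixed state is then a good enough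
  approximation.  At smaller depth the state itself will do, because each layer multiplies the
  Schmidt rank by at most \<open>16\<^sup>\<kappa>\<close>: at most one gate of a layer straddles the cut.

  The contraction of \<open>F\<close> is a consequence of the hypercontractive bound
  \<open>\<parallel>T X\<parallel>\<^sub>4 \<le> \<parallel>X\<parallel>\<^sub>2\<close> (in normalised norms) for strong noise \<open>T\<close>.  For positive \<open>X\<close> of trace one,
  two applications of Cauchy-Schwarz bound \<open>\<parallel>T X\<parallel>\<^sub>2\<^sup>2 = \<langle>X, T\<^sup>2 X\<rangle>\<close> by \<open>\<parallel>X\<parallel>\<^sub>2\<close> up to normalisation.
  Weak noise is reduced to strong noise by log-convexity along the semigroup,
  \<open>\<parallel>T X\<parallel>\<^sub>2\<^sup>2 \<le> \<parallel>X\<parallel>\<^sub>2 \<parallel>T\<^sup>2 X\<parallel>\<^sub>2\<close>.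
\<close>

section \<open>Square arrays of complex numbers\<close>

text \<open>Functions on index pairs let blocks, transposes and linear combinations be formed
  without dimension side conditions; only the entries below the dimension \<open>d\<close>
  count.\<close>

type_synonym array = "nat \<Rightarrow> nat \<Rightarrow> complex"

definition frob2 :: "nat \<Rightarrow> array \<Rightarrow> real" where
  "frob2 d X = (\<Sum>i<d. \<Sum>j<d. (cmod (X i j))\<^sup>2)"

definition frob_inner :: "nat \<Rightarrow> array \<Rightarrow> array \<Rightarrow> complex" where
  "frob_inner d X Y = (\<Sum>i<d. \<Sum>j<d. X i j * cnj (Y i j))"

text \<open>This is X Y^H, with ^H for the conjugate transpose. Hence
  \<open>frob2 d (mul_adj d X X)\<close> is the fourth power of the Schatten 4-norm of X, the
  quantity that hypercontractivity controls.\<close>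

definition mul_adj :: "nat \<Rightarrow> array \<Rightarrow> array \<Rightarrow> array" where
  "mul_adj d X Y = (\<lambda>i j. \<Sum>k<d. X i k * cnj (Y j k))"

lemma frob2_nonneg [simp]: "0 \<le> frob2 d X"
  by (simp add: frob2_def sum_nonneg)

lemma frob2_cong:
  "(\<And>i j. i < d \<Longrightarrow> j < d \<Longrightarrow> X i j = Y i j) \<Longrightarrow> frob2 d X = frob2 d Y"
  by (simp add: frob2_def)

lemma frob_inner_cong:
  "(\<And>i j. i < d \<Longrightarrow> j < d \<Longrightarrow> X i j = X' i j) \<Longrightarrow>
   (\<And>i j. i < d \<Longrightarrow> j < d \<Longrightarrow> Y i j = Y' i j) \<Longrightarrow>
   frob_inner d X Y = frob_inner d X' Y'"
  by (simp add: frob_inner_def)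

lemma frob_inner_self: "frob_inner d X X = complex_of_real (frob2 d X)"
  by (simp only: frob_inner_def frob2_def complex_norm_square of_real_sum)

lemma norm_sum_mult_cnj_le:
  fixes f g :: "'a \<Rightarrow> complex"
  shows "(cmod (\<Sum>x\<in>A. f x * cnj (g x)))\<^sup>2 \<le> (\<Sum>x\<in>A. (cmod (f x))\<^sup>2) * (\<Sum>x\<in>A. (cmod (g x))\<^sup>2)"
proof -
  have "cmod (\<Sum>x\<in>A. f x * cnj (g x)) \<le> (\<Sum>x\<in>A. \<bar>cmod (f x)\<bar> * \<bar>cmod (g x)\<bar>)"
    by (rule order_trans[OF norm_sum]) (simp add: norm_mult)
  also have "\<dots> \<le> L2_set (\<lambda>x. cmod (f x)) A * L2_set (\<lambda>x. cmod (g x)) A"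
    by (rule L2_set_mult_ineq)
  finally have "(cmod (\<Sum>x\<in>A. f x * cnj (g x)))\<^sup>2
      \<le> (L2_set (\<lambda>x. cmod (f x)) A * L2_set (\<lambda>x. cmod (g x)) A)\<^sup>2"
    by (rule power_mono) simp
  then show ?thesis
    by (simp add: power_mult_distrib L2_set_def sum_nonneg)
qed

lemma frob2_alt: "frob2 d X = (\<Sum>(i, j)\<in>{..<d} \<times> {..<d}. (cmod (X i j))\<^sup>2)"
  by (simp add: frob2_def sum.cartesian_product)

lemma frob_inner_le: "(cmod (frob_inner d X Y))\<^sup>2 \<le> frob2 d X * frob2 d Y"
proof -
  have "frob_inner d X Y = (\<Sum>p\<in>{..<d} \<times> {..<d}. X (fst p) (snd p) * cnj (Y (fst p) (snd p)))"
    by (simp add: frob_inner_def sum.cartesian_product case_prod_unfold)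
  moreover have "frob2 d Z = (\<Sum>p\<in>{..<d} \<times> {..<d}. (cmod (Z (fst p) (snd p)))\<^sup>2)" for Z
    by (simp add: frob2_alt case_prod_unfold)
  ultimately show ?thesis
    using norm_sum_mult_cnj_le[of "\<lambda>p. X (fst p) (snd p)" "\<lambda>p. Y (fst p) (snd p)" "{..<d} \<times> {..<d}"]
    by simp
qed

lemma frob_inner_le_sqrt: "cmod (frob_inner d X Y) \<le> sqrt (frob2 d X) * sqrt (frob2 d Y)"
  using frob_inner_le[of d X Y] by (simp add: real_le_rsqrt real_sqrt_mult[symmetric])

lemma frob_inner_add_right:
  "frob_inner d Z (\<lambda>i j. X i j + Y i j) = frob_inner d Z X + frob_inner d Z Y"
  by (simp add: frob_inner_def algebra_simps sum.distrib)

lemma frob2_add: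
  "frob2 d (\<lambda>i j. X i j + Y i j) = frob2 d X + frob2 d Y + 2 * Re (frob_inner d X Y)"
proof -
  have "(cmod (x + y))\<^sup>2 = (cmod x)\<^sup>2 + (cmod y)\<^sup>2 + 2 * Re (x * cnj y)" for x y
    unfolding cmod_power2 by (simp add: power2_eq_square algebra_simps)
  then show ?thesis
    by (simp add: frob2_def frob_inner_def sum.distrib sum_distrib_left)
qed

lemma frob2_scale: "frob2 d (\<lambda>i j. c * X i j) = (cmod c)\<^sup>2 * frob2 d X"
  by (simp add: frob2_def norm_mult power_mult_distrib sum_distrib_left)

lemma frob_inner_scale_right:
  "frob_inner d X (\<lambda>i j. complex_of_real c * Y i j) = complex_of_real c * frob_inner d X Y"
  by (simp add: frob_inner_def sum_distrib_left mult_ac)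

lemma frob2_add_le: "frob2 d (\<lambda>i j. X i j + Y i j) \<le> 2 * frob2 d X + 2 * frob2 d Y"
proof -
  have "Re (frob_inner d X Y) \<le> sqrt (frob2 d X) * sqrt (frob2 d Y)"
    by (rule order_trans[OF complex_Re_le_cmod frob_inner_le_sqrt])
  moreover have "2 * (sqrt (frob2 d X) * sqrt (frob2 d Y)) \<le> frob2 d X + frob2 d Y"
    using sum_squares_bound[of "sqrt (frob2 d X)" "sqrt (frob2 d Y)"] by simp
  ultimately show ?thesis
    unfolding frob2_add by linarith
qed

lemma sqrt_frob2_add_le:
  "sqrt (frob2 d (\<lambda>i j. X i j + Y i j)) \<le> sqrt (frob2 d X) + sqrt (frob2 d Y)"
proof (rule real_le_lsqrt)
  have "Re (frob_inner d X Y) \<le> sqrt (frob2 d X) * sqrt (frob2 d Y)"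
    by (rule order_trans[OF complex_Re_le_cmod frob_inner_le_sqrt])
  then show "frob2 d (\<lambda>i j. X i j + Y i j) \<le> (sqrt (frob2 d X) + sqrt (frob2 d Y))\<^sup>2"
    unfolding frob2_add by (simp add: power2_sum)
qed simp

section \<open>Estimates for the Schatten 4-norm\<close>

text \<open>Both sides equal tr((X X^H)^2): transposing turns X X^H into the complex conjugate of
  X^H X, and cyclicity of the trace, here an exchange of summations, identifies the two
  norms.\<close>

lemma frob2_mul_adj_transpose:
  "frob2 d (mul_adj d (\<lambda>i j. X j i) (\<lambda>i j. X j i)) = frob2 d (mul_adj d X X)"
proof -
  have eq: "complex_of_real (frob2 d (mul_adj d Y Y)) =
    (\<Sum>i<d. \<Sum>j<d. \<Sum>k<d. \<Sum>l<d. Y i k * cnj (Y j k) * (cnj (Y i l) * Y j l))" for Y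
    by (simp add: frob_inner_self[symmetric] frob_inner_def mul_adj_def sum_product)
  have "(\<Sum>i<d. \<Sum>j<d. \<Sum>k<d. \<Sum>l<d. X k i * cnj (X k j) * (cnj (X l i) * X l j))
     = (\<Sum>i<d. \<Sum>k<d. \<Sum>j<d. \<Sum>l<d. X k i * cnj (X k j) * (cnj (X l i) * X l j))"
    by (rule sum.cong[OF refl]) (rule sum.swap)
  also have "\<dots> = (\<Sum>k<d. \<Sum>i<d. \<Sum>j<d. \<Sum>l<d. X k i * cnj (X k j) * (cnj (X l i) * X l j))"
    by (rule sum.swap)
  also have "\<dots> = (\<Sum>k<d. \<Sum>i<d. \<Sum>l<d. \<Sum>j<d. X k i * cnj (X k j) * (cnj (X l i) * X l j))"
    by (rule sum.cong[OF refl], rule sum.cong[OF refl], rule sum.swap)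
  also have "\<dots> = (\<Sum>k<d. \<Sum>l<d. \<Sum>i<d. \<Sum>j<d. X k i * cnj (X k j) * (cnj (X l i) * X l j))"
    by (rule sum.cong[OF refl]) (rule sum.swap)
  finally have "complex_of_real (frob2 d (mul_adj d (\<lambda>i j. X j i) (\<lambda>i j. X j i)))
      = complex_of_real (frob2 d (mul_adj d X X))"
    unfolding eq by (simp add: mult_ac)
  then show ?thesis
    by (simp only: of_real_eq_iff)
qed

text \<open>The left side is tr(X Y^H Y X^H), the inner product of X^H X and Y^H Y. Cauchy-Schwarz
  and the transposition lemma then give this case of Hoelder's inequality for the 4-norm.\<close>

lemma frob2_mul_adj_le:
  "frob2 d (mul_adj d X Y) \<le> sqrt (frob2 d (mul_adj d X X)) * sqrt (frob2 d (mul_adj d Y Y))"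
proof -
  let ?t = "\<lambda>X i j. X j i"
  have "complex_of_real (frob2 d (mul_adj d X Y)) =
    (\<Sum>i<d. \<Sum>j<d. \<Sum>k<d. \<Sum>l<d. X i k * cnj (Y j k) * (cnj (X i l) * Y j l))"
    by (simp add: frob_inner_self[symmetric] frob_inner_def mul_adj_def sum_product)
  also have "\<dots> = (\<Sum>i<d. \<Sum>k<d. \<Sum>j<d. \<Sum>l<d. X i k * cnj (Y j k) * (cnj (X i l) * Y j l))"
    by (rule sum.cong[OF refl]) (rule sum.swap)
  also have "\<dots> = (\<Sum>k<d. \<Sum>i<d. \<Sum>j<d. \<Sum>l<d. X i k * cnj (Y j k) * (cnj (X i l) * Y j l))"
    by (rule sum.swap)
  also have "\<dots> = (\<Sum>k<d. \<Sum>i<d. \<Sum>l<d. \<Sum>j<d. X i k * cnj (Y j k) * (cnj (X i l) * Y j l))"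
    by (rule sum.cong[OF refl], rule sum.cong[OF refl], rule sum.swap)
  also have "\<dots> = (\<Sum>k<d. \<Sum>l<d. \<Sum>i<d. \<Sum>j<d. X i k * cnj (Y j k) * (cnj (X i l) * Y j l))"
    by (rule sum.cong[OF refl]) (rule sum.swap)
  also have "\<dots> = frob_inner d (mul_adj d (?t X) (?t X)) (mul_adj d (?t Y) (?t Y))"
    by (simp add: frob_inner_def mul_adj_def sum_product mult_ac)
  finally have "cmod (complex_of_real (frob2 d (mul_adj d X Y)))
      = cmod (frob_inner d (mul_adj d (?t X) (?t X)) (mul_adj d (?t Y) (?t Y)))"
    by (rule arg_cong)
  then have "frob2 d (mul_adj d X Y)
      = cmod (frob_inner d (mul_adj d (?t X) (?t X)) (mul_adj d (?t Y) (?t Y)))"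
    by simp
  also have "\<dots> \<le> sqrt (frob2 d (mul_adj d (?t X) (?t X))) * sqrt (frob2 d (mul_adj d (?t Y) (?t Y)))"
    by (rule frob_inner_le_sqrt)
  finally show ?thesis
    by (simp only: frob2_mul_adj_transpose[of d X] frob2_mul_adj_transpose[of d Y])
qed

text \<open>Z Z^H is a quadratic polynomial in \<open>r\<close> with coefficients \<open>S0\<close>,
  \<open>S1\<close>, \<open>S2\<close>. In its squared norm the term of order r vanishes by
  \<open>orth\<close>; those of order r^2 to r^4 are bounded through \<open>a\<close> and
  \<open>v\<close>, the squared 4-norms of A and V.\<close>

lemma quartic_norm_perturb:
  fixes r :: real
  assumes r: "0 \<le> r"
    and orth: "Re (frob_inner d (mul_adj d A A) (\<lambda>i j. mul_adj d A V i j + mul_adj d V A i j)) = 0"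
  defines "Z \<equiv> \<lambda>i j. A i j + complex_of_real r * V i j"
    and "a \<equiv> sqrt (frob2 d (mul_adj d A A))" and "v \<equiv> sqrt (frob2 d (mul_adj d V V))"
  shows "frob2 d (mul_adj d Z Z) \<le> a\<^sup>2 + (6 * r^2 + 2 * r^3) * (a * v) + (2 * r^3 + r^4) * v\<^sup>2"
proof -
  define S0 where "S0 = mul_adj d A A"
  define S1 where "S1 = (\<lambda>i j. mul_adj d A V i j + mul_adj d V A i j)"
  define S2 where "S2 = mul_adj d V V"
  have [simp]: "0 \<le> a" "0 \<le> v" by (simp_all add: a_def v_def)
  have a2: "frob2 d S0 = a\<^sup>2" and v2: "frob2 d S2 = v\<^sup>2"
    by (simp_all add: a_def v_def S0_def S2_def)
  have ZZ: "mul_adj d Z Z = (\<lambda>i j. S0 i j + complex_of_real r * (S1 i j + complex_of_real r * S2 i j))"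
    by (simp add: mul_adj_def Z_def S0_def S1_def S2_def algebra_simps sum.distrib sum_distrib_left fun_eq_iff)
  have "frob2 d S1 \<le> 2 * frob2 d (mul_adj d A V) + 2 * frob2 d (mul_adj d V A)"
    unfolding S1_def by (rule frob2_add_le)
  also have "\<dots> \<le> 4 * (a * v)"
    using frob2_mul_adj_le[of d A V] frob2_mul_adj_le[of d V A]
    unfolding a_def v_def by (simp add: mult.commute)
  finally have S1: "frob2 d S1 \<le> 4 * (a * v)" .
  have c02: "Re (frob_inner d S0 S2) \<le> a * v"
    using frob_inner_le_sqrt[of d S0 S2] complex_Re_le_cmod[of "frob_inner d S0 S2"]
    unfolding a_def v_def S0_def S2_def by linarith
  have "Re (frob_inner d S1 S2) \<le> sqrt (frob2 d S1) * v"
    using frob_inner_le_sqrt[of d S1 S2] complex_Re_le_cmod[of "frob_inner d S1 S2"]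
    unfolding v_def S2_def by linarith
  \<comment> \<open>The halves are chosen so that, with \<open>S1\<close> at most 4 a v in squared
    norm, this mean inequality yields exactly a v + v^2.\<close>
  moreover have "2 * (sqrt (frob2 d S1) / 2 * v) \<le> (sqrt (frob2 d S1) / 2)\<^sup>2 + v\<^sup>2"
    using sum_squares_bound[of "sqrt (frob2 d S1) / 2" v] by simp
  ultimately have c12: "Re (frob_inner d S1 S2) \<le> a * v + v\<^sup>2"
    using S1 by (simp add: power_divide)
  have "frob2 d (mul_adj d Z Z) = a\<^sup>2 + r\<^sup>2 * (frob2 d S1 + r\<^sup>2 * v\<^sup>2 + 2 * r * Re (frob_inner d S1 S2))
      + 2 * r * (Re (frob_inner d S0 S1) + r * Re (frob_inner d S0 S2))"
    unfolding ZZ frob2_add frob2_scale frob_inner_scale_right frob_inner_add_right a2 v2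
    by simp
  also have "\<dots> = a\<^sup>2 + r^2 * frob2 d S1 + r^4 * v\<^sup>2 + 2 * r^3 * Re (frob_inner d S1 S2)
      + 2 * r^2 * Re (frob_inner d S0 S2)"
    using orth unfolding S0_def[symmetric] S1_def[symmetric]
    by (simp add: algebra_simps power2_eq_square power3_eq_cube power4_eq_xxxx)
  also have "\<dots> \<le> a\<^sup>2 + r^2 * (4 * (a * v)) + r^4 * v\<^sup>2 + 2 * r^3 * (a * v + v\<^sup>2) + 2 * r^2 * (a * v)"
    using r S1 c02 c12 by (intro add_mono mult_left_mono order_refl) auto
  finally show ?thesis
    by (simp add: algebra_simps)
qed

section \<open>Tensor powers of the depolarizing channel\<close>

lemma index_bit_less_2 [simp]: "index_bit q k < 2"
  by (simp add: index_bit_def)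

lemma index_bit_add_mult_power:
  assumes "q < n"
  shows "index_bit q (a * 2 ^ n + i) = index_bit q i"
proof -
  obtain k where "n = Suc (q + k)"
    using assms less_imp_Suc_add by blast
  then have "a * 2 ^ n = (a * 2 ^ k * 2) * 2 ^ q"
    by (simp add: power_add)
  then have "(a * 2 ^ n + i) div 2 ^ q = a * 2 ^ k * 2 + i div 2 ^ q"
    by (simp only: div_mult_self3 power_not_zero zero_neq_numeral[symmetric] not_False_eq_True)
  then show ?thesis
    by (simp add: index_bit_def)
qed

lemma index_bit_top: "i < 2 ^ n \<Longrightarrow> a < 2 \<Longrightarrow> index_bit n (a * 2 ^ n + i) = a"
  by (simp add: index_bit_def)

lemma sum_lessThan_mult:
  fixes f :: "nat \<Rightarrow> 'a::comm_monoid_add"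
  shows "(\<Sum>k<m * d. f k) = (\<Sum>a<m. \<Sum>k<d. f (a * d + k))"
proof (induction m)
  case (Suc m)
  have "(\<Sum>k<Suc m * d. f k) = (\<Sum>k<m * d. f k) + (\<Sum>k=m * d..<Suc m * d. f k)"
    by (simp add: lessThan_atLeast0 sum.atLeastLessThan_concat)
  also have "(\<Sum>k=m * d..<Suc m * d. f k) = (\<Sum>k<d. f (m * d + k))"
    using sum.shift_bounds_nat_ivl[of f 0 "m * d" d]
    by (simp add: lessThan_atLeast0 add.commute)
  finally show ?case
    using Suc by simp
qed simp

lemma sum_less_2: "(\<Sum>a<2. f a) = f 0 + f (Suc 0)"
  by (simp add: numeral_2_eq_2)

text \<open>As \<open>k\<close> runs below 2^n its bits take all combinations independently, so this
  is the distributive law; the induction peels off the highest bit.\<close>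

lemma sum_prod_index_bit:
  fixes g :: "nat \<Rightarrow> nat \<Rightarrow> 'a::comm_semiring_1"
  shows "(\<Sum>k<2 ^ n. \<Prod>q<n. g q (index_bit q k)) = (\<Prod>q<n. \<Sum>b<2. g q b)"
proof (induction n)
  case (Suc n)
  have "(\<Sum>k<2 ^ Suc n. \<Prod>q<Suc n. g q (index_bit q k))
      = (\<Sum>a<2. \<Sum>k<2 ^ n. (\<Prod>q<n. g q (index_bit q k)) * g n a)"
    unfolding power_Suc sum_lessThan_mult
    by (intro sum.cong refl) (simp add: index_bit_top index_bit_add_mult_power)
  also have "\<dots> = (\<Prod>q<n. \<Sum>b<2. g q b) * (\<Sum>a<2. g n a)"
    by (simp add: Suc sum_distrib_right[symmetric] sum_distrib_left)
  finally show ?case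
    by simp
qed simp

lemma sum_sum_prod_index_bit:
  fixes g :: "nat \<Rightarrow> nat \<Rightarrow> nat \<Rightarrow> 'a::comm_semiring_1"
  shows "(\<Sum>k<2 ^ n. \<Sum>l<2 ^ n. \<Prod>q<n. g q (index_bit q k) (index_bit q l))
    = (\<Prod>q<n. \<Sum>a<2. \<Sum>b<2. g q a b)"
proof -
  have "(\<Sum>k<2 ^ n. \<Sum>l<2 ^ n. \<Prod>q<n. g q (index_bit q k) (index_bit q l))
      = (\<Sum>k<2 ^ n. \<Prod>q<n. \<Sum>b<2. g q (index_bit q k) b)"
    by (rule sum.cong[OF refl], rule sum_prod_index_bit)
  also have "\<dots> = (\<Prod>q<n. \<Sum>a<2. \<Sum>b<2. g q a b)"
    by (rule sum_prod_index_bit)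
  finally show ?thesis .
qed

section \<open>The noise channel as a kernel\<close>

text \<open>The (i, j) entry of the channel applied to the matrix unit with indices (k, l). The
  parameter \<open>r\<close> is the surviving weight 1 - lam, because these weights multiply under
  composition.\<close>

definition depol_kernel :: "real \<Rightarrow> nat \<Rightarrow> nat \<Rightarrow> nat \<Rightarrow> nat \<Rightarrow> complex" where
  "depol_kernel r k l i j =
     (if k = i \<and> l = j then of_real r else 0) + (if k = l \<and> i = j then of_real ((1 - r) / 2) else 0)"

definition noise_kernel :: "real \<Rightarrow> nat \<Rightarrow> nat \<Rightarrow> nat \<Rightarrow> nat \<Rightarrow> nat \<Rightarrow> complex" where
  "noise_kernel r n k l i j =
     (\<Prod>q<n. depol_kernel r (index_bit q k) (index_bit q l) (index_bit q i) (index_bit q j))"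

definition noise :: "real \<Rightarrow> nat \<Rightarrow> array \<Rightarrow> array" where
  "noise r n X = (\<lambda>i j. \<Sum>k<2 ^ n. \<Sum>l<2 ^ n. X k l * noise_kernel r n k l i j)"

lemma depol_kernel_commute: "depol_kernel r k l i j = depol_kernel r i j k l"
  by (auto simp: depol_kernel_def)

lemma noise_kernel_commute: "noise_kernel r n k l i j = noise_kernel r n i j k l"
  unfolding noise_kernel_def by (rule prod.cong[OF refl], rule depol_kernel_commute)

lemma cnj_depol_kernel: "cnj (depol_kernel r k l i j) = depol_kernel r k l i j"
  by (auto simp: depol_kernel_def)

lemma cnj_noise_kernel: "cnj (noise_kernel r n k l i j) = noise_kernel r n k l i j"
  by (simp add: noise_kernel_def cnj_depol_kernel)

lemma less_2E: "a < 2 \<Longrightarrow> (a = 0 \<Longrightarrow> P) \<Longrightarrow> (a = Suc 0 \<Longrightarrow> P) \<Longrightarrow> P" for a :: nat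
  by linarith

lemma depol_kernel_compose:
  assumes "a < 2" "b < 2" "i < 2" "j < 2"
  shows "(\<Sum>k<2. \<Sum>l<2. depol_kernel s a b k l * depol_kernel r k l i j) = depol_kernel (r * s) a b i j"
  using assms
  by (elim less_2E) (simp_all add: depol_kernel_def sum_less_2 field_simps)

lemma noise_kernel_compose:
  "(\<Sum>k<2 ^ n. \<Sum>l<2 ^ n. noise_kernel s n a b k l * noise_kernel r n k l i j)
    = noise_kernel (r * s) n a b i j"
proof -
  have "(\<Sum>k<2 ^ n. \<Sum>l<2 ^ n. noise_kernel s n a b k l * noise_kernel r n k l i j)
      = (\<Sum>k<2 ^ n. \<Sum>l<2 ^ n. \<Prod>q<n.
          (\<lambda>q k l. depol_kernel s (index_bit q a) (index_bit q b) k l *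
                    depol_kernel r k l (index_bit q i) (index_bit q j)) q (index_bit q k) (index_bit q l))"
    by (simp only: noise_kernel_def prod.distrib)
  also have "\<dots> = (\<Prod>q<n. \<Sum>k<2. \<Sum>l<2. depol_kernel s (index_bit q a) (index_bit q b) k l *
                    depol_kernel r k l (index_bit q i) (index_bit q j))"
    by (rule sum_sum_prod_index_bit)
  finally show ?thesis
    by (simp only: noise_kernel_def depol_kernel_compose index_bit_less_2)
qed

text \<open>The semigroup law is inherited qubit by qubit from the one-qubit kernels. It lets weak
  noise be compared with its own strong powers.\<close>

lemma noise_noise: "noise r n (noise s n X) = noise (r * s) n X"
proof (intro ext)
  fix i j
  let ?N = "{..<2 ^ n::nat}"
  have "noise r n (noise s n X) i j
      = (\<Sum>(k, l)\<in>?N \<times> ?N. \<Sum>(a, b)\<in>?N \<times> ?N. X a b * noise_kernel s n a b k l * noise_kernel r n k l i j)"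
    by (simp only: noise_def sum.cartesian_product[symmetric] sum_distrib_right)
  also have "\<dots> = (\<Sum>(a, b)\<in>?N \<times> ?N. \<Sum>(k, l)\<in>?N \<times> ?N.
      X a b * noise_kernel s n a b k l * noise_kernel r n k l i j)"
    unfolding case_prod_unfold by (rule sum.swap)
  also have "\<dots> = (\<Sum>a<2 ^ n. \<Sum>b<2 ^ n. X a b *
      (\<Sum>k<2 ^ n. \<Sum>l<2 ^ n. noise_kernel s n a b k l * noise_kernel r n k l i j))"
    by (simp only: sum.cartesian_product[symmetric] sum_distrib_left mult.assoc)
  finally show "noise r n (noise s n X) i j = noise (r * s) n X i j"
    by (simp add: noise_kernel_compose noise_def)
qed

text \<open>The channel is self-adjoint because its kernel is real and symmetric under exchange of
  input and output indices.\<close>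

lemma frob_inner_noise: "frob_inner (2 ^ n) (noise r n X) Y = frob_inner (2 ^ n) X (noise r n Y)"
proof -
  let ?N = "{..<2 ^ n::nat}"
  have "frob_inner (2 ^ n) (noise r n X) Y
      = (\<Sum>(i, j)\<in>?N \<times> ?N. \<Sum>(k, l)\<in>?N \<times> ?N. X k l * noise_kernel r n k l i j * cnj (Y i j))"
    by (simp only: frob_inner_def noise_def sum.cartesian_product[symmetric] sum_distrib_right)
  also have "\<dots> = (\<Sum>(k, l)\<in>?N \<times> ?N. \<Sum>(i, j)\<in>?N \<times> ?N. X k l * noise_kernel r n k l i j * cnj (Y i j))"
    unfolding case_prod_unfold by (rule sum.swap)
  also have "\<dots> = frob_inner (2 ^ n) X (noise r n Y)"
    unfolding sum.cartesian_product[symmetric] frob_inner_def noise_def cnj_sum sum_distrib_left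
      complex_cnj_mult cnj_noise_kernel
    by (intro sum.cong refl) (simp add: noise_kernel_commute[of r n i j for i j] mult_ac)
  finally show ?thesis .
qed

lemma noise_add: "noise r n (\<lambda>i j. X i j + Y i j) i j = noise r n X i j + noise r n Y i j"
  by (simp add: noise_def algebra_simps sum.distrib)

lemma noise_scale: "noise r n (\<lambda>i j. c * X i j) i j = c * noise r n X i j"
  by (simp add: noise_def sum_distrib_left mult.assoc)

section \<open>Splitting off the leading qubit\<close>

definition blk :: "nat \<Rightarrow> array \<Rightarrow> nat \<Rightarrow> nat \<Rightarrow> array" where
  "blk d X a b = (\<lambda>i j. X (a * d + i) (b * d + j))"

lemma frob_inner_blk:
  "frob_inner (m * d) X Y = (\<Sum>a<m. \<Sum>b<m. frob_inner d (blk d X a b) (blk d Y a b))"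
proof -
  have "frob_inner (m * d) X Y = (\<Sum>a<m. \<Sum>i<d. \<Sum>b<m. \<Sum>j<d. X (a * d + i) (b * d + j) * cnj (Y (a * d + i) (b * d + j)))"
    by (simp add: frob_inner_def sum_lessThan_mult)
  also have "\<dots> = (\<Sum>a<m. \<Sum>b<m. \<Sum>i<d. \<Sum>j<d. X (a * d + i) (b * d + j) * cnj (Y (a * d + i) (b * d + j)))"
    by (rule sum.cong[OF refl]) (rule sum.swap)
  finally show ?thesis
    by (simp add: frob_inner_def blk_def)
qed

lemma frob2_blk: "frob2 (m * d) X = (\<Sum>a<m. \<Sum>b<m. frob2 d (blk d X a b))"
proof -
  have "complex_of_real (frob2 (m * d) X) = complex_of_real (\<Sum>a<m. \<Sum>b<m. frob2 d (blk d X a b))"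
    by (simp only: frob_inner_self[symmetric] frob_inner_blk of_real_sum)
  then show ?thesis
    by (simp only: of_real_eq_iff)
qed

lemma blk_mul_adj:
  "blk d (mul_adj (m * d) X Y) a c = (\<lambda>i j. \<Sum>b<m. mul_adj d (blk d X a b) (blk d Y c b) i j)"
  by (simp add: blk_def mul_adj_def sum_lessThan_mult)

text \<open>The top bit of an index belongs to the leading qubit, so the kernel factors into a
  one-qubit kernel and the noise on the other \<open>n\<close> qubits. This recursion drives the
  inductions on \<open>n\<close>.\<close>

lemma noise_Suc:
  assumes "a < 2" "b < 2" "i < 2 ^ n" "j < 2 ^ n"
  shows "noise r (Suc n) X (a * 2 ^ n + i) (b * 2 ^ n + j) =
    (\<Sum>a'<2. \<Sum>b'<2. depol_kernel r a' b' a b * noise r n (blk (2 ^ n) X a' b') i j)"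
proof -
  have ker: "noise_kernel r (Suc n) (a' * 2 ^ n + k) (b' * 2 ^ n + l) (a * 2 ^ n + i) (b * 2 ^ n + j)
      = depol_kernel r a' b' a b * noise_kernel r n k l i j"
    if "a' < 2" "b' < 2" "k < 2 ^ n" "l < 2 ^ n" for a' b' k l
    using assms that by (simp add: noise_kernel_def index_bit_top index_bit_add_mult_power)
  have "noise r (Suc n) X (a * 2 ^ n + i) (b * 2 ^ n + j) =
    (\<Sum>a'<2. \<Sum>k<2 ^ n. \<Sum>b'<2. \<Sum>l<2 ^ n. X (a' * 2 ^ n + k) (b' * 2 ^ n + l) *
       (depol_kernel r a' b' a b * noise_kernel r n k l i j))"
    unfolding noise_def power_Suc sum_lessThan_mult
    by (intro sum.cong refl) (simp add: ker)
  also have "\<dots> = (\<Sum>a'<2. \<Sum>b'<2. \<Sum>k<2 ^ n. \<Sum>l<2 ^ n. X (a' * 2 ^ n + k) (b' * 2 ^ n + l) *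
       (depol_kernel r a' b' a b * noise_kernel r n k l i j))"
    by (rule sum.cong[OF refl]) (rule sum.swap)
  finally show ?thesis
    by (simp add: noise_def blk_def sum_distrib_left mult_ac)
qed

text \<open>A diagonal matrix unit keeps weight r + (1 - r)/2 in place and sends (1 - r)/2 to the
  other diagonal entry; off-diagonal units contribute nothing to the trace.\<close>

lemma depol_kernel_trace:
  "(\<Sum>a<2. \<Sum>a'<2. \<Sum>b'<2. depol_kernel r a' b' a a * f a' b') = f 0 0 + f (Suc 0) (Suc 0)"
proof -
  have *: "(complex_of_real r + complex_of_real ((1 - r) / 2)) * x + complex_of_real ((1 - r) / 2) * y
    + (complex_of_real ((1 - r) / 2) * x + (complex_of_real r + complex_of_real ((1 - r) / 2)) * y) = x + y"
    for x y
    by (simp add: field_simps)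
  show ?thesis
    using *[of "f 0 0" "f (Suc 0) (Suc 0)"] by (simp add: sum_less_2 depol_kernel_def)
qed

lemma trace_noise: "(\<Sum>i<2 ^ n. noise r n X i i) = (\<Sum>i<2 ^ n. X i i)"
proof (induction n arbitrary: X)
  case 0
  show ?case by (simp add: noise_def noise_kernel_def)
next
  case (Suc n)
  have "(\<Sum>i<2 ^ Suc n. noise r (Suc n) X i i)
      = (\<Sum>a<2. \<Sum>i<2 ^ n. \<Sum>a'<2. \<Sum>b'<2. depol_kernel r a' b' a a * noise r n (blk (2 ^ n) X a' b') i i)"
    unfolding power_Suc sum_lessThan_mult
    by (intro sum.cong refl) (simp add: noise_Suc)
  also have "\<dots> = (\<Sum>i<2 ^ n. \<Sum>a<2. \<Sum>a'<2. \<Sum>b'<2. depol_kernel r a' b' a a * noise r n (blk (2 ^ n) X a' b') i i)"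
    by (rule sum.swap)
  also have "\<dots> = (\<Sum>i<2 ^ n. noise r n (blk (2 ^ n) X 0 0) i i) + (\<Sum>i<2 ^ n. noise r n (blk (2 ^ n) X (Suc 0) (Suc 0)) i i)"
    by (simp only: depol_kernel_trace sum.distrib)
  also have "\<dots> = (\<Sum>i<2 ^ Suc n. X i i)"
    unfolding Suc power_Suc sum_lessThan_mult by (simp add: sum_less_2 blk_def)
  finally show ?case .
qed

section \<open>Positivity and its preservation by the noise\<close>

text \<open>Gram form X = B B^H. Preservation under a map in Kraus form then reduces to multiplying
  B by the Kraus operators.\<close>

definition psd :: "nat \<Rightarrow> array \<Rightarrow> bool" where
  "psd d X \<longleftrightarrow> (\<exists>N :: nat. \<exists>B. \<forall>i<d. \<forall>j<d. X i j = (\<Sum>m<N. B i m * cnj (B j m)))"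

lemma psdI:
  assumes "finite M" "\<And>i j. i < d \<Longrightarrow> j < d \<Longrightarrow> X i j = (\<Sum>m\<in>M. B i m * cnj (B j m))"
  shows "psd d X"
proof -
  obtain h where "bij_betw h {0..<card M} M"
    using ex_bij_betw_nat_finite[OF assms(1)] by blast
  then have "bij_betw h {..<card M} M"
    by (simp add: lessThan_atLeast0)
  then have "X i j = (\<Sum>m<card M. B i (h m) * cnj (B j (h m)))" if "i < d" "j < d" for i j
    using assms(2)[OF that] by (simp add: sum.reindex_bij_betw[symmetric])
  then show ?thesis
    unfolding psd_def by (intro exI[of _ "card M"] exI[of _ "\<lambda>i m. B i (h m)"]) simp
qed

text \<open>The five Kraus operators are the identity scaled by sqrt r and the four matrix units
  scaled by sqrt((1 - r)/2); the latter together send X to (1 - r)/2 tr X times the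
  identity.\<close>

lemma depol_kernel_Kraus:
  assumes "0 \<le> r" "r \<le> 1"
  shows "\<exists>K. \<forall>a<2. \<forall>b<2. \<forall>i<2. \<forall>j<2. depol_kernel r a b i j = (\<Sum>m<(5::nat). K m i a * cnj (K m j b))"
proof -
  define c d where "c = complex_of_real (sqrt r)" and "d = complex_of_real (sqrt ((1 - r) / 2))"
  have c: "c * cnj c = of_real r" and d: "d * cnj d = of_real ((1 - r) / 2)"
    using assms by (simp_all only: c_def d_def complex_cnj_complex_of_real of_real_mult[symmetric]
        real_sqrt_mult_self) simp_all
  define K :: "nat \<Rightarrow> nat \<Rightarrow> nat \<Rightarrow> complex" where
    "K m i a =
      (if m = 0 then if i = a then c else 0
       else if m = 1 then if i = 0 \<and> a = 0 then d else 0
       else if m = 2 then if i = 0 \<and> a = 1 then d else 0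
       else if m = 3 then if i = 1 \<and> a = 0 then d else 0
       else if i = 1 \<and> a = 1 then d else 0)" for m i a
  have K_simps: "K 0 i a = (if i = a then c else 0)" "K (Suc 0) i a = (if i = 0 \<and> a = 0 then d else 0)"
    "K 2 i a = (if i = 0 \<and> a = 1 then d else 0)" "K 3 i a = (if i = 1 \<and> a = 0 then d else 0)"
    "K 4 i a = (if i = 1 \<and> a = 1 then d else 0)" for i a
    by (simp_all add: K_def)
  have sum5: "(\<Sum>m<5. f m) = f 0 + f (Suc 0) + f 2 + f 3 + f 4" for f :: "nat \<Rightarrow> complex"
    by (simp add: eval_nat_numeral)
  have "depol_kernel r a b i j = (\<Sum>m<5. K m i a * cnj (K m j b))"
    if "a < 2" "b < 2" "i < 2" "j < 2" for a b i j
    using that unfolding sum5 K_simps depol_kernel_def c[symmetric] d[symmetric]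
    by (elim less_2E) simp_all
  then show ?thesis
    by blast
qed

text \<open>Expanding the product over qubits of the Kraus sums gives one Kraus operator
  \<open>G f\<close> for each choice function \<open>f\<close>. The pairs (f, p) number the columns
  of the new Gram factor.\<close>

lemma psd_noise:
  assumes "0 \<le> r" "r \<le> 1" and "psd (2 ^ n) X"
  shows "psd (2 ^ n) (noise r n X)"
proof -
  obtain K where K: "\<And>a b i j. a < 2 \<Longrightarrow> b < 2 \<Longrightarrow> i < 2 \<Longrightarrow> j < 2 \<Longrightarrow>
      depol_kernel r a b i j = (\<Sum>m<(5::nat). K m i a * cnj (K m j b))"
    using depol_kernel_Kraus[OF assms(1,2)] by blast
  obtain N :: nat and B where B: "\<And>i j. i < 2 ^ n \<Longrightarrow> j < 2 ^ n \<Longrightarrow> X i j = (\<Sum>p<N. B i p * cnj (B j p))"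
    using assms(3) unfolding psd_def by blast
  define F where "F = ({..<n} \<rightarrow>\<^sub>E {..<5::nat})"
  define G where "G f i k = (\<Prod>q<n. K (f q) (index_bit q i) (index_bit q k))" for f :: "nat \<Rightarrow> nat" and i k
  have ker: "noise_kernel r n k l i j = (\<Sum>f\<in>F. G f i k * cnj (G f j l))" for k l i j
    by (simp add: noise_kernel_def K prod_sum_PiE F_def G_def prod.distrib)
  have "noise r n X i j = (\<Sum>(f, p)\<in>F \<times> {..<N}. (\<Sum>k<2 ^ n. B k p * G f i k) * cnj (\<Sum>l<2 ^ n. B l p * G f j l))"
    if "i < 2 ^ n" "j < 2 ^ n" for i j
  proof -
    have "noise r n X i j = (\<Sum>k<2 ^ n. \<Sum>l<2 ^ n. (\<Sum>p<N. B k p * cnj (B l p)) *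
        (\<Sum>f\<in>F. G f i k * cnj (G f j l)))"
      by (simp add: noise_def ker B)
    also have "\<dots> = (\<Sum>k<2 ^ n. \<Sum>l<2 ^ n. \<Sum>f\<in>F. \<Sum>p<N. (B k p * G f i k) * cnj (B l p * G f j l))"
      unfolding sum_product by (subst sum.swap) (simp add: mult_ac)
    also have "\<dots> = (\<Sum>(k, l)\<in>{..<2 ^ n} \<times> {..<2 ^ n}. \<Sum>(f, p)\<in>F \<times> {..<N}.
        (B k p * G f i k) * cnj (B l p * G f j l))"
      by (simp only: sum.cartesian_product[symmetric])
    also have "\<dots> = (\<Sum>(f, p)\<in>F \<times> {..<N}. \<Sum>(k, l)\<in>{..<2 ^ n} \<times> {..<2 ^ n}.
        (B k p * G f i k) * cnj (B l p * G f j l))"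
      unfolding case_prod_unfold by (rule sum.swap)
    also have "\<dots> = (\<Sum>(f, p)\<in>F \<times> {..<N}. (\<Sum>k<2 ^ n. B k p * G f i k) * cnj (\<Sum>l<2 ^ n. B l p * G f j l))"
      by (simp only: sum_product sum.cartesian_product[symmetric] cnj_sum)
    finally show ?thesis .
  qed
  then show ?thesis
    by (intro psdI[where M = "F \<times> {..<N}" and B = "\<lambda>i (f, p). \<Sum>k<2 ^ n. B k p * G f i k"])
       (auto simp: F_def case_prod_unfold intro!: finite_PiE)
qed

section \<open>Hypercontractivity and decay of the purity\<close>

lemma frob2_sum_two_le:
  "sqrt (frob2 d (\<lambda>i j. \<Sum>b<2. Y b i j)) \<le> (\<Sum>b<(2::nat). sqrt (frob2 d (Y b)))"
  by (simp add: sum_less_2 sqrt_frob2_add_le)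

text \<open>Block (a, c) of V V^H is the sum over b of V_ab (V_cb)^H. By Hoelder and Cauchy-Schwarz
  its squared norm is at most the product of the row sums of \<open>q\<close> for a and c; adding
  over a and c gives the square of the full sum.\<close>

lemma sqrt_frob2_mul_adj_blocks_le:
  "sqrt (frob2 (2 * d) (mul_adj (2 * d) V V))
    \<le> (\<Sum>a<2. \<Sum>b<2. sqrt (frob2 d (mul_adj d (blk d V a b) (blk d V a b))))"
proof -
  define q where "q a b = sqrt (frob2 d (mul_adj d (blk d V a b) (blk d V a b)))" for a b
  have q: "0 \<le> q a b" for a b by (simp add: q_def)
  have "frob2 d (blk d (mul_adj (2 * d) V V) a c) \<le> (\<Sum>b<2. q a b) * (\<Sum>b<2. q c b)" for a c
  proof -
    have "sqrt (frob2 d (blk d (mul_adj (2 * d) V V) a c)) \<le>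
        (\<Sum>b<2. sqrt (frob2 d (mul_adj d (blk d V a b) (blk d V c b))))"
      unfolding blk_mul_adj by (rule frob2_sum_two_le)
    also have "\<dots> \<le> (\<Sum>b<2. sqrt (q a b * q c b))"
      unfolding q_def by (intro sum_mono real_sqrt_le_mono frob2_mul_adj_le)
    also have "\<dots> \<le> sqrt ((\<Sum>b<2. q a b) * (\<Sum>b<2. q c b))"
    proof (rule real_le_rsqrt)
      \<comment> \<open>The two-term Cauchy-Schwarz inequality comes down to the
        arithmetic-geometric mean inequality for its cross term.\<close>
      have "2 * (sqrt (q a 0 * q c 0) * sqrt (q a (Suc 0) * q c (Suc 0)))
          = 2 * (sqrt (q a 0 * q c (Suc 0)) * sqrt (q a (Suc 0) * q c 0))"
        by (simp add: real_sqrt_mult)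
      also have "\<dots> \<le> q a 0 * q c (Suc 0) + q a (Suc 0) * q c 0"
        using sum_squares_bound[of "sqrt (q a 0 * q c (Suc 0))" "sqrt (q a (Suc 0) * q c 0)"] q
        by simp
      finally show "(\<Sum>b<2. sqrt (q a b * q c b))\<^sup>2 \<le> (\<Sum>b<2. q a b) * (\<Sum>b<2. q c b)"
        using q by (simp add: sum_less_2 power2_sum algebra_simps)
    qed
    finally show ?thesis
      by simp
  qed
  then have "frob2 (2 * d) (mul_adj (2 * d) V V) \<le> (\<Sum>a<2. \<Sum>c<2. (\<Sum>b<2. q a b) * (\<Sum>b<2. q c b))"
    unfolding frob2_blk by (intro sum_mono)
  also have "\<dots> = (\<Sum>a<2. \<Sum>b<2. q a b)\<^sup>2"
    by (simp add: power2_eq_square sum_product)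
  finally show ?thesis
    unfolding q_def[symmetric] by (intro real_le_lsqrt sum_nonneg q) simp
qed

text \<open>
  The noise on the leading qubit splits \<open>X\<close> into \<open>W\<close> tensored with the identity and \<open>r V\<close>, where \<open>V\<close>
  has vanishing partial trace.  The term linear in \<open>r\<close> in the expansion of the quartic norm
  vanishes for this reason, and the remaining terms are absorbed because \<open>r \<le> 1/3\<close>.
\<close>

lemma noise_hypercontractive:
  assumes "0 \<le> r" "r \<le> 1 / 3"
  shows "frob2 (2 ^ n) (mul_adj (2 ^ n) (noise r n X) (noise r n X)) \<le> (frob2 (2 ^ n) X)\<^sup>2 / 2 ^ n"
proof (induction n arbitrary: X)
  case 0
  show ?case
    by (simp add: frob2_def mul_adj_def noise_def noise_kernel_def norm_mult power2_eq_square)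
next
  case (Suc n)
  define d :: nat where "d = 2 ^ n"
  have d: "0 < d" by (simp add: d_def)
  \<comment> \<open>With this normalisation the induction hypothesis bounds the squared 4-norm of
    the noisy Y by \<open>s\<close> times the squared 2-norm of Y.\<close>
  define s where "s = 1 / sqrt (2 ^ n)"
  have s: "0 < s" "s\<^sup>2 = 1 / 2 ^ n" by (simp_all add: s_def power_divide)
  \<comment> \<open>\<open>w\<close> is half the partial trace of X over the leading qubit, and
    \<open>V0\<close> holds the blocks of X minus identity tensor \<open>w\<close>. After noise on
    the other qubits these become \<open>A\<close>, which is identity tensor \<open>W\<close>, and
    \<open>V\<close>.\<close>
  define w where "w = (\<lambda>i j. (1 / 2) * (blk d X 0 0 i j + blk d X (Suc 0) (Suc 0) i j))"
  define V0 where "V0 a b = (\<lambda>i j. blk d X a b i j + (if a = b then - 1 else 0) * w i j)" for a b :: nat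
  define W where "W = noise r n w"
  define A :: array where "A = (\<lambda>i j. if i div d = j div d then W (i mod d) (j mod d) else 0)"
  define V :: array where "V = (\<lambda>i j. noise r n (V0 (i div d) (j div d)) (i mod d) (j mod d))"
  have blkA: "blk d A a b i j = (if a = b then W i j else 0)" if "i < d" "j < d" for a b i j
    using that by (simp add: blk_def A_def)
  have blkV: "blk d V a b i j = noise r n (V0 a b) i j" if "i < d" "j < d" for a b i j
    using that by (simp add: blk_def V_def)
  have noise_V0: "noise r n (V0 a b) i j = noise r n (blk d X a b) i j + (if a = b then - 1 else 0) * W i j"
    for a b i j
    unfolding V0_def noise_add noise_scale W_def ..
  have W_eq: "W i j = (1 / 2) * (noise r n (blk d X 0 0) i j + noise r n (blk d X (Suc 0) (Suc 0)) i j)" for i j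
    unfolding W_def w_def noise_add noise_scale ..
  have split: "noise r (Suc n) X (a * d + i) (b * d + j)
      = A (a * d + i) (b * d + j) + complex_of_real r * V (a * d + i) (b * d + j)"
    if "a < 2" "b < 2" "i < d" "j < d" for a b i j
  proof -
    have "noise r (Suc n) X (a * d + i) (b * d + j)
        = (\<Sum>a'<2. \<Sum>b'<2. depol_kernel r a' b' a b * noise r n (blk d X a' b') i j)"
      unfolding d_def by (rule noise_Suc) (use that in \<open>simp_all add: d_def\<close>)
    also have "\<dots> = blk d A a b i j + complex_of_real r * blk d V a b i j"
      unfolding blkA[OF that(3,4)] blkV[OF that(3,4)] noise_V0 W_eq using that(1,2)
      by (elim less_2E) (simp_all add: sum_less_2 depol_kernel_def field_simps)
    finally show ?thesis
      by (simp add: blk_def)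
  qed
  have noise_eq: "noise r (Suc n) X i j = A i j + complex_of_real r * V i j" if "i < 2 * d" "j < 2 * d" for i j
    using split[of "i div d" "j div d" "i mod d" "j mod d"] that d
    by (simp add: less_mult_imp_div_less)
  \<comment> \<open>This is the vanishing partial trace of \<open>V\<close>.\<close>
  have V11: "blk d V (Suc 0) (Suc 0) i j = - blk d V 0 0 i j" if "i < d" "j < d" for i j
    using that by (simp add: blkV noise_V0 W_eq field_simps)
  have blkAA: "blk d (mul_adj (2 * d) A A) a c i j = (if a = c then mul_adj d W W i j else 0)"
    if "a < 2" "c < 2" "i < d" "j < d" for a c i j
    using that unfolding blk_mul_adj sum_less_2 by (elim less_2E) (simp_all add: mul_adj_def blkA)
  \<comment> \<open>A A^H is block diagonal with both blocks equal to W W^H, so the inner product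
    sees only the sum of the diagonal blocks of \<open>?S\<close>, and these cancel by
    \<open>V11\<close>.\<close>
  have orth: "Re (frob_inner (2 * d) (mul_adj (2 * d) A A)
      (\<lambda>i j. mul_adj (2 * d) A V i j + mul_adj (2 * d) V A i j)) = 0"
  proof -
    let ?S = "\<lambda>i j. mul_adj (2 * d) A V i j + mul_adj (2 * d) V A i j"
    have blkS: "blk d ?S a a i j = mul_adj d W (blk d V a a) i j + mul_adj d (blk d V a a) W i j"
      if "a < 2" "i < d" "j < d" for a i j
    proof -
      have "blk d ?S a a i j = blk d (mul_adj (2 * d) A V) a a i j + blk d (mul_adj (2 * d) V A) a a i j"
        by (simp add: blk_def)
      then show ?thesis
        using that unfolding blk_mul_adj sum_less_2 by (elim less_2E) (simp_all add: mul_adj_def blkA)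
    qed
    have less: "0 < (2::nat)" "Suc 0 < 2" by simp_all
    have neg: "blk d ?S (Suc 0) (Suc 0) i j = - blk d ?S 0 0 i j" if "i < d" "j < d" for i j
      unfolding blkS[OF less(1) that] blkS[OF less(2) that]
      using that by (simp add: mul_adj_def V11 sum_negf)
    have "frob_inner (2 * d) (mul_adj (2 * d) A A) ?S
        = (\<Sum>a<2. \<Sum>c<2. frob_inner d (\<lambda>i j. if a = c then mul_adj d W W i j else 0) (blk d ?S a c))"
      unfolding frob_inner_blk by (intro sum.cong refl frob_inner_cong) (simp_all add: blkAA)
    also have "\<dots> = frob_inner d (mul_adj d W W) (blk d ?S 0 0)
        + frob_inner d (mul_adj d W W) (blk d ?S (Suc 0) (Suc 0))"
      by (simp add: sum_less_2 frob_inner_def)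
    also have "frob_inner d (mul_adj d W W) (blk d ?S (Suc 0) (Suc 0))
        = frob_inner d (mul_adj d W W) (\<lambda>i j. complex_of_real (- 1) * blk d ?S 0 0 i j)"
      by (intro frob_inner_cong refl) (simp add: neg)
    finally show ?thesis
      unfolding frob_inner_scale_right by simp
  qed
  define a where "a = sqrt (frob2 (2 * d) (mul_adj (2 * d) A A))"
  define v where "v = sqrt (frob2 (2 * d) (mul_adj (2 * d) V V))"
  define \<alpha> where "\<alpha> = frob2 d w"
  define \<beta> where "\<beta> = (\<Sum>a<2. \<Sum>b<2. frob2 d (V0 a b))"
  have nonneg: "0 \<le> a" "0 \<le> v" "0 \<le> \<alpha>" "0 \<le> \<beta>"
    by (simp_all add: a_def v_def \<alpha>_def \<beta>_def sum_nonneg)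
  have IH: "sqrt (frob2 d (mul_adj d (noise r n Y) (noise r n Y))) \<le> s * frob2 d Y" for Y
  proof (rule real_le_lsqrt)
    show "frob2 d (mul_adj d (noise r n Y) (noise r n Y)) \<le> (s * frob2 d Y)\<^sup>2"
      using Suc[of Y] by (simp add: power_mult_distrib s d_def)
  qed (use s in simp)
  have "frob2 (2 * d) (mul_adj (2 * d) A A)
      = (\<Sum>a<(2::nat). \<Sum>c<2. frob2 d (\<lambda>i j. if a = c then mul_adj d W W i j else 0))"
    unfolding frob2_blk by (intro sum.cong refl frob2_cong) (simp add: blkAA)
  also have "\<dots> = 2 * frob2 d (mul_adj d W W)"
    by (simp add: sum_less_2 frob2_def)
  also have "\<dots> \<le> 2 * (\<alpha>\<^sup>2 / 2 ^ n)"
    using Suc[of w] unfolding W_def \<alpha>_def d_def by simp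
  finally have a2: "a\<^sup>2 \<le> 2 * s\<^sup>2 * \<alpha>\<^sup>2"
    by (simp add: a_def s)
  \<comment> \<open>The factor 3/2 is a rational upper bound for sqrt 2.\<close>
  have a: "a \<le> 3 / 2 * s * \<alpha>"
  proof (rule power2_le_imp_le)
    have "2 * (s\<^sup>2 * \<alpha>\<^sup>2) \<le> 9 / 4 * (s\<^sup>2 * \<alpha>\<^sup>2)"
      by (intro mult_right_mono) simp_all
    moreover have "(3 / 2 * s * \<alpha>)\<^sup>2 = 9 / 4 * (s\<^sup>2 * \<alpha>\<^sup>2)"
      by (simp add: power2_eq_square)
    ultimately show "a\<^sup>2 \<le> (3 / 2 * s * \<alpha>)\<^sup>2"
      using a2 by linarith
  qed (use s nonneg in simp)
  have "v \<le> (\<Sum>a<2. \<Sum>b<2. sqrt (frob2 d (mul_adj d (blk d V a b) (blk d V a b))))"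
    unfolding v_def by (rule sqrt_frob2_mul_adj_blocks_le)
  also have "\<dots> = (\<Sum>a<2. \<Sum>b<2. sqrt (frob2 d (mul_adj d (noise r n (V0 a b)) (noise r n (V0 a b)))))"
    by (intro sum.cong refl arg_cong[where f = sqrt] frob2_cong) (simp add: mul_adj_def blkV)
  also have "\<dots> \<le> (\<Sum>a<2. \<Sum>b<2. s * frob2 d (V0 a b))"
    by (intro sum_mono IH)
  finally have v: "v \<le> s * \<beta>"
    by (simp add: \<beta>_def sum_distrib_left)
  \<comment> \<open>Pythagoras: identity tensor \<open>w\<close> is orthogonal to the part with
    vanishing partial trace, and the identity on the leading qubit doubles the squared norm of
    \<open>w\<close>.\<close>
  have X: "frob2 (2 * d) X = 2 * \<alpha> + \<beta>"
  proof -
    have *: "(cmod x)\<^sup>2 + (cmod y)\<^sup>2 = 2 * (cmod (1 / 2 * (x + y)))\<^sup>2 +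
        ((cmod (x + - 1 * (1 / 2 * (x + y))))\<^sup>2 + (cmod (y + - 1 * (1 / 2 * (x + y))))\<^sup>2)" for x y
      unfolding cmod_power2 by (simp add: power2_eq_square field_simps)
    have diag: "frob2 d (blk d X 0 0) + frob2 d (blk d X (Suc 0) (Suc 0))
        = 2 * \<alpha> + (frob2 d (V0 0 0) + frob2 d (V0 (Suc 0) (Suc 0)))"
      unfolding frob2_def \<alpha>_def sum_distrib_left sum.distrib[symmetric]
      by (intro sum.cong refl) (simp only: V0_def w_def if_True simp_thms, rule *)
    have "frob2 d (V0 0 (Suc 0)) = frob2 d (blk d X 0 (Suc 0))"
      "frob2 d (V0 (Suc 0) 0) = frob2 d (blk d X (Suc 0) 0)"
      by (simp_all add: V0_def)
    then show ?thesis
      using diag unfolding frob2_blk \<beta>_def sum_less_2 by linarith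
  qed
  have r2: "r^2 \<le> 1 / 9" and r3: "r^3 \<le> 1 / 27" and r4: "r^4 \<le> 1 / 81"
    using power_mono[OF assms(2,1), of 2] power_mono[OF assms(2,1), of 3] power_mono[OF assms(2,1), of 4]
    by (simp_all add: power_divide)
  have "frob2 (2 ^ Suc n) (mul_adj (2 ^ Suc n) (noise r (Suc n) X) (noise r (Suc n) X))
      = frob2 (2 * d) (mul_adj (2 * d) (\<lambda>i j. A i j + complex_of_real r * V i j) (\<lambda>i j. A i j + complex_of_real r * V i j))"
    unfolding d_def power_Suc[symmetric]
    by (intro frob2_cong) (simp add: mul_adj_def noise_eq d_def)
  also have "\<dots> \<le> a\<^sup>2 + (6 * r^2 + 2 * r^3) * (a * v) + (2 * r^3 + r^4) * v\<^sup>2"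
    unfolding a_def v_def by (rule quartic_norm_perturb[OF assms(1) orth])
  \<comment> \<open>For r at most 1/3 the two coefficients are at most 20/27 and 7/81.\<close>
  also have "\<dots> \<le> a\<^sup>2 + 1 * (a * v) + (1 / 2) * v\<^sup>2"
    using r2 r3 r4 nonneg by (intro add_mono mult_right_mono) auto
  also have "\<dots> \<le> 2 * s\<^sup>2 * \<alpha>\<^sup>2 + 1 * ((3 / 2 * s * \<alpha>) * (s * \<beta>)) + (1 / 2) * (s * \<beta>)\<^sup>2"
    using a2 a v nonneg s by (intro add_mono mult_left_mono mult_mono power_mono) auto
  \<comment> \<open>The terms in \<open>\<alpha>\<close> squared and \<open>\<beta>\<close> squared
    agree on both sides; the square has mixed coefficient 2 where only 3/2 is required.\<close>
  also have "\<dots> \<le> s\<^sup>2 / 2 * (2 * \<alpha> + \<beta>)\<^sup>2"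
  proof -
    have "2 * s\<^sup>2 * \<alpha>\<^sup>2 + 1 * ((3 / 2 * s * \<alpha>) * (s * \<beta>)) + (1 / 2) * (s * \<beta>)\<^sup>2
        = s\<^sup>2 / 2 * (2 * \<alpha> + \<beta>)\<^sup>2 - s\<^sup>2 * (\<alpha> * \<beta>) / 2"
      by (simp add: power2_eq_square field_simps)
    then show ?thesis
      using nonneg by simp
  qed
  also have "\<dots> = (frob2 (2 ^ Suc n) X)\<^sup>2 / 2 ^ Suc n"
    using X by (simp add: s d_def)
  finally show ?case .
qed

section \<open>Decay of the purity under one layer of noise\<close>

lemma le_cmod_of_real: "complex_of_real x = z \<Longrightarrow> x \<le> cmod z"
  by auto

text \<open>For X = B B^H, the number tr(X Y^H) pairs B with Y^H B. Cauchy-Schwarz gives the factors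
  tr(B B^H) = tr X and tr(B^H Y Y^H B) = tr(X Y Y^H); the moduli only turn these real quantities of
  complex type into reals.\<close>

lemma psd_frob_inner_le:
  assumes "psd d X"
  shows "(cmod (frob_inner d X Y))\<^sup>2 \<le> cmod (\<Sum>i<d. X i i) * cmod (frob_inner d X (mul_adj d Y Y))"
proof -
  obtain N :: nat and B where B: "\<And>i j. i < d \<Longrightarrow> j < d \<Longrightarrow> X i j = (\<Sum>m<N. B i m * cnj (B j m))"
    using assms unfolding psd_def by blast
  \<comment> \<open>This is B^H Y with its two indices exchanged.\<close>
  define Z where "Z j m = (\<Sum>i<d. cnj (B i m) * Y i j)" for j m
  let ?P = "{..<d} \<times> {..<N}"
  have "frob_inner d X Y = (\<Sum>i<d. \<Sum>j<d. \<Sum>m<N. B i m * cnj (B j m) * cnj (Y i j))"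
    by (simp add: frob_inner_def B sum_distrib_right)
  also have "\<dots> = (\<Sum>j<d. \<Sum>i<d. \<Sum>m<N. B i m * cnj (B j m) * cnj (Y i j))"
    by (rule sum.swap)
  also have "\<dots> = (\<Sum>j<d. \<Sum>m<N. \<Sum>i<d. B i m * cnj (B j m) * cnj (Y i j))"
    by (rule sum.cong[OF refl]) (rule sum.swap)
  also have "\<dots> = (\<Sum>(j, m)\<in>?P. cnj (B j m) * cnj (Z j m))"
    by (simp add: Z_def sum_distrib_left sum.cartesian_product[symmetric] mult_ac)
  finally have 1: "frob_inner d X Y = (\<Sum>p\<in>?P. cnj (B (fst p) (snd p)) * cnj (Z (fst p) (snd p)))"
    by (simp add: case_prod_unfold)
  have "complex_of_real (\<Sum>p\<in>?P. (cmod (cnj (B (fst p) (snd p))))\<^sup>2) = (\<Sum>(j, m)\<in>?P. B j m * cnj (B j m))"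
    by (simp only: of_real_sum complex_norm_square complex_mod_cnj case_prod_unfold)
  also have "\<dots> = (\<Sum>i<d. X i i)"
    by (simp add: B sum.cartesian_product[symmetric])
  finally have 2: "(\<Sum>p\<in>?P. (cmod (cnj (B (fst p) (snd p))))\<^sup>2) \<le> cmod (\<Sum>i<d. X i i)"
    by (rule le_cmod_of_real)
  have "complex_of_real (\<Sum>p\<in>?P. (cmod (Z (fst p) (snd p)))\<^sup>2) = (\<Sum>j<d. \<Sum>m<N. Z j m * cnj (Z j m))"
    by (simp only: of_real_sum complex_norm_square case_prod_unfold sum.cartesian_product)
  also have "\<dots> = (\<Sum>j<d. \<Sum>m<N. cnj (Z j m) * Z j m)"
    by (simp only: mult.commute)
  also have "\<dots> = (\<Sum>j<d. \<Sum>m<N. \<Sum>i<d. \<Sum>i'<d. B i m * cnj (B i' m) * (cnj (Y i j) * Y i' j))"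
    by (simp add: Z_def sum_product mult_ac)
  also have "\<dots> = (\<Sum>j<d. \<Sum>i<d. \<Sum>m<N. \<Sum>i'<d. B i m * cnj (B i' m) * (cnj (Y i j) * Y i' j))"
    by (rule sum.cong[OF refl]) (rule sum.swap)
  also have "\<dots> = (\<Sum>i<d. \<Sum>j<d. \<Sum>m<N. \<Sum>i'<d. B i m * cnj (B i' m) * (cnj (Y i j) * Y i' j))"
    by (rule sum.swap)
  also have "\<dots> = (\<Sum>i<d. \<Sum>j<d. \<Sum>i'<d. \<Sum>m<N. B i m * cnj (B i' m) * (cnj (Y i j) * Y i' j))"
    by (rule sum.cong[OF refl], rule sum.cong[OF refl], rule sum.swap)
  also have "\<dots> = (\<Sum>i<d. \<Sum>i'<d. \<Sum>j<d. \<Sum>m<N. B i m * cnj (B i' m) * (cnj (Y i j) * Y i' j))"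
    by (rule sum.cong[OF refl]) (rule sum.swap)
  also have "\<dots> = frob_inner d X (mul_adj d Y Y)"
    by (simp add: frob_inner_def B mul_adj_def sum_distrib_left sum_distrib_right)
  finally have 3: "(\<Sum>p\<in>?P. (cmod (Z (fst p) (snd p)))\<^sup>2) \<le> cmod (frob_inner d X (mul_adj d Y Y))"
    by (rule le_cmod_of_real)
  have "(cmod (frob_inner d X Y))\<^sup>2 \<le> (\<Sum>p\<in>?P. (cmod (cnj (B (fst p) (snd p))))\<^sup>2) * (\<Sum>p\<in>?P. (cmod (Z (fst p) (snd p)))\<^sup>2)"
    unfolding 1 by (rule norm_sum_mult_cnj_le)
  also have "\<dots> \<le> cmod (\<Sum>i<d. X i i) * cmod (frob_inner d X (mul_adj d Y Y))"
    by (intro mult_mono 2 3 sum_nonneg) auto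
  finally show ?thesis .
qed

lemma frob2_noise_eq: "complex_of_real (frob2 (2 ^ n) (noise r n X)) = frob_inner (2 ^ n) X (noise (r * r) n X)"
  by (simp only: frob_inner_self[symmetric] frob_inner_noise noise_noise)

text \<open>Let Y be X after two applications of the noise, so that f is the inner product of X and
  Y. Positivity, Cauchy-Schwarz and hypercontractivity applied to the once-noisy X bound f^2 by f
  times the root of the right side, and one factor f cancels.\<close>

lemma frob2_strong_noise_le:
  assumes "0 \<le> r" "r \<le> 1 / 3" and "psd (2 ^ n) X" and tr: "(\<Sum>i<2 ^ n. X i i) = 1"
  shows "(frob2 (2 ^ n) (noise r n X))\<^sup>2 \<le> frob2 (2 ^ n) X / 2 ^ n"
proof -
  define f where "f = frob2 (2 ^ n) (noise r n X)"
  define Y where "Y = noise r n (noise r n X)"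
  have f: "complex_of_real f = frob_inner (2 ^ n) X Y"
    unfolding f_def Y_def frob2_noise_eq noise_noise ..
  have "f\<^sup>2 = (cmod (frob_inner (2 ^ n) X Y))\<^sup>2"
    unfolding f[symmetric] by simp
  also have "\<dots> \<le> cmod (frob_inner (2 ^ n) X (mul_adj (2 ^ n) Y Y))"
    using psd_frob_inner_le[OF assms(3), of Y] unfolding tr by simp
  also have "\<dots> \<le> sqrt (frob2 (2 ^ n) X) * sqrt (frob2 (2 ^ n) (mul_adj (2 ^ n) Y Y))"
    by (rule frob_inner_le_sqrt)
  also have "\<dots> \<le> sqrt (frob2 (2 ^ n) X) * sqrt (f\<^sup>2 / 2 ^ n)"
    unfolding Y_def f_def by (intro mult_left_mono real_sqrt_le_mono noise_hypercontractive assms) simp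
  also have "\<dots> = f * sqrt (frob2 (2 ^ n) X / 2 ^ n)"
    by (simp add: real_sqrt_divide f_def)
  finally have *: "f * f \<le> f * sqrt (frob2 (2 ^ n) X / 2 ^ n)"
    by (simp add: power2_eq_square)
  have "f \<le> sqrt (frob2 (2 ^ n) X / 2 ^ n)"
  proof (cases "f = 0")
    case False
    then have "0 < f" by (simp add: f_def less_le)
    then show ?thesis using * by simp
  qed simp
  then have "f\<^sup>2 \<le> (sqrt (frob2 (2 ^ n) X / 2 ^ n))\<^sup>2"
    by (rule power_mono) (simp add: f_def)
  then show ?thesis
    unfolding f_def by simp
qed

text \<open>Self-adjointness and the semigroup law give g(t)^2 <= f g(t^2), where g is the squared
  norm after noise and f the one before. Iterating \<open>m\<close> times raises the parameter to
  the power 2^m, that is, to strong noise.\<close>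

lemma frob2_noise_power_le:
  "(frob2 (2 ^ n) (noise r n X)) ^ (2 ^ m)
    \<le> (frob2 (2 ^ n) X) ^ (2 ^ m - 1) * frob2 (2 ^ n) (noise (r ^ (2 ^ m)) n X)"
proof (induction m)
  case (Suc m)
  let ?g = "\<lambda>r. frob2 (2 ^ n) (noise r n X)" and ?f = "frob2 (2 ^ n) X"
  have step: "(?g t)\<^sup>2 \<le> ?f * ?g (t * t)" for t
  proof -
    have "(?g t)\<^sup>2 = (cmod (frob_inner (2 ^ n) X (noise (t * t) n X)))\<^sup>2"
      unfolding frob2_noise_eq[symmetric] by simp
    also have "\<dots> \<le> ?f * ?g (t * t)"
      by (rule frob_inner_le)
    finally show ?thesis .
  qed
  have "(?g r) ^ (2 ^ Suc m) = ((?g r) ^ (2 ^ m))\<^sup>2"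
    by (simp add: power_mult[symmetric] mult.commute)
  also have "\<dots> \<le> (?f ^ (2 ^ m - 1) * ?g (r ^ (2 ^ m)))\<^sup>2"
    by (rule power_mono[OF Suc]) simp
  also have "\<dots> \<le> (?f ^ (2 ^ m - 1))\<^sup>2 * (?f * ?g (r ^ (2 ^ m) * r ^ (2 ^ m)))"
    unfolding power_mult_distrib by (rule mult_left_mono[OF step]) simp
  also have "\<dots> = ?f ^ (2 ^ Suc m - 1) * ?g (r ^ (2 ^ Suc m))"
  proof -
    have "2 ^ Suc m - 1 = (2 ^ m - 1) * 2 + (1::nat)"
      by (cases "2 ^ m :: nat") auto
    then have "?f ^ (2 ^ Suc m - 1) = (?f ^ (2 ^ m - 1))\<^sup>2 * ?f"
      by (simp add: power_add power_mult del: power_Suc)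
    moreover have "r ^ (2 ^ m) * r ^ (2 ^ m) = r ^ (2 ^ Suc m)"
      by (simp add: power_add[symmetric] mult_2)
    ultimately show ?thesis by simp
  qed
  finally show ?case .
qed simp

text \<open>Cauchy-Schwarz between the diagonal of X and the all-ones vector. It makes the logarithm
  of the normalised purity nonnegative.\<close>

lemma one_le_frob2:
  assumes "(\<Sum>i<2 ^ n. X i i) = 1"
  shows "1 \<le> 2 ^ n * frob2 (2 ^ n) X"
proof -
  have "1 = (cmod (\<Sum>i<2 ^ n. X i i * cnj 1))\<^sup>2"
    using assms by simp
  also have "\<dots> \<le> (\<Sum>i<2 ^ n. (cmod (X i i))\<^sup>2) * (\<Sum>i<2 ^ n::nat. (cmod 1)\<^sup>2)"
    by (rule norm_sum_mult_cnj_le)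
  also have "(\<Sum>i<2 ^ n. (cmod (X i i))\<^sup>2) \<le> frob2 (2 ^ n) X"
    unfolding frob2_def
    by (intro sum_mono) (rule member_le_sum[where f = "\<lambda>j. (cmod (X _ j))\<^sup>2"], auto)
  finally show ?thesis
    by (simp add: mult.commute)
qed

text \<open>For trace one the maximally mixed state is the orthogonal projection of X onto the
  multiples of the identity, so the squared norms subtract.\<close>

lemma frob2_diff_maximally_mixed:
  assumes tr: "(\<Sum>i<2 ^ n. X i i) = 1"
  shows "frob2 (2 ^ n) (\<lambda>i j. X i j - (if i = j then 1 / 2 ^ n else 0)) = frob2 (2 ^ n) X - 1 / 2 ^ n"
proof -
  let ?I = "\<lambda>i j. if i = j then (1::complex) else 0"
  let ?c = "- 1 / 2 ^ n :: real"
  have I: "frob2 (2 ^ n) ?I = 2 ^ n"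
    by (simp add: frob2_def if_distrib[of cmod] if_distrib[of "\<lambda>x. x\<^sup>2"] cong: if_cong)
  have "frob_inner (2 ^ n) X ?I = (\<Sum>i<2 ^ n. X i i)"
    by (simp add: frob_inner_def if_distrib cong: if_cong)
  then have XI: "frob_inner (2 ^ n) X ?I = 1"
    using tr by simp
  have "frob2 (2 ^ n) (\<lambda>i j. X i j - (if i = j then 1 / 2 ^ n else 0))
      = frob2 (2 ^ n) (\<lambda>i j. X i j + complex_of_real ?c * ?I i j)"
    by (rule frob2_cong) simp
  also have "\<dots> = frob2 (2 ^ n) X + (cmod (complex_of_real ?c))\<^sup>2 * 2 ^ n + 2 * ?c"
    unfolding frob2_add frob2_scale frob_inner_scale_right I XI by simp
  also have "\<dots> = frob2 (2 ^ n) X - 1 / 2 ^ n"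
    by (simp only: norm_of_real) (simp add: power2_eq_square field_simps)
  finally show ?thesis .
qed

text \<open>The rate \<open>\<eta>\<close> is fixed before \<open>n\<close> and \<open>X\<close>. It
  comes from reaching strong noise by repeated squaring of the parameter and then combining
  \<open>frob2_noise_power_le\<close> with \<open>frob2_strong_noise_le\<close>.\<close>

lemma purity_decay:
  assumes r: "0 \<le> r" "r < 1"
  obtains \<eta> :: real where "0 < \<eta>" "\<eta> < 1"
    "\<And>n X. psd (2 ^ n) X \<Longrightarrow> (\<Sum>i<2 ^ n. X i i) = 1 \<Longrightarrow>
       ln (2 ^ n * frob2 (2 ^ n) (noise r n X)) \<le> \<eta> * ln (2 ^ n * frob2 (2 ^ n) X)"
proof -
  \<comment> \<open>Since 2^m0 is at least m0, the parameter is below 1/3 after m0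
    squarings.\<close>
  obtain m0 where m0: "r ^ m0 < 1 / 3"
    using real_arch_pow_inv[of "1 / 3" r] r by auto
  have "r ^ (2 ^ m0) \<le> r ^ m0"
    using r by (intro power_decreasing) (simp_all add: less_imp_le)
  then have rm: "r ^ (2 ^ m0) \<le> 1 / 3" using m0 by linarith
  define M :: nat where "M = 2 ^ m0"
  have M: "0 < M" by (simp add: M_def)
  define \<eta> where "\<eta> = real (2 * M - 1) / real (2 * M)"
  have "0 < \<eta>" "\<eta> < 1"
    using M by (simp_all add: \<eta>_def)
  moreover have "ln (2 ^ n * frob2 (2 ^ n) (noise r n X)) \<le> \<eta> * ln (2 ^ n * frob2 (2 ^ n) X)"
    if X: "psd (2 ^ n) X" and tr: "(\<Sum>i<2 ^ n. X i i) = 1" for n X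
  proof -
    let ?f = "frob2 (2 ^ n) X" and ?g = "frob2 (2 ^ n) (noise r n X)"
    have f1: "1 \<le> 2 ^ n * ?f" and g1: "1 \<le> 2 ^ n * ?g"
      using one_le_frob2 tr by (simp_all add: one_le_frob2 trace_noise)
    have "?g ^ (2 * M) = (?g ^ M)\<^sup>2"
      by (simp add: power_mult[symmetric] mult.commute)
    also have "\<dots> \<le> (?f ^ (M - 1) * frob2 (2 ^ n) (noise (r ^ M) n X))\<^sup>2"
      unfolding M_def by (rule power_mono[OF frob2_noise_power_le]) simp
    also have "\<dots> \<le> (?f ^ (M - 1))\<^sup>2 * (?f / 2 ^ n)"
      unfolding power_mult_distrib M_def
      by (intro mult_left_mono frob2_strong_noise_le rm X tr) (use r in simp_all)
    also have "\<dots> = ?f ^ (2 * M - 1) / 2 ^ n"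
    proof -
      have "2 * M - 1 = (M - 1) * 2 + 1" using M by simp
      then show ?thesis by (simp add: power_add power_mult)
    qed
    finally have "?g ^ (2 * M) \<le> ?f ^ (2 * M - 1) / 2 ^ n" .
    \<comment> \<open>Multiplying by this power normalises both purities: one factor 2^n cancels the
      denominator, leaving 2 M - 1 of them to match the exponent on the right.\<close>
    then have "(2 ^ n) ^ (2 * M) * ?g ^ (2 * M) \<le> (2 ^ n) ^ (2 * M) * (?f ^ (2 * M - 1) / 2 ^ n)"
      by (rule mult_left_mono) simp
    also have "\<dots> = (2 ^ n * ?f) ^ (2 * M - 1)"
    proof -
      have "(2 ^ n :: real) ^ (2 * M) = 2 ^ n * (2 ^ n) ^ (2 * M - 1)"
        using M by (subst power_Suc[symmetric]) simp
      then show ?thesis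
        by (simp only: power_mult_distrib) simp
    qed
    finally have "(2 ^ n * ?g) ^ (2 * M) \<le> (2 ^ n * ?f) ^ (2 * M - 1)"
      by (simp only: power_mult_distrib)
    then have "ln ((2 ^ n * ?g) ^ (2 * M)) \<le> ln ((2 ^ n * ?f) ^ (2 * M - 1))"
      using f1 g1 by (subst ln_le_cancel_iff) (auto intro!: zero_less_power)
    then have "real (2 * M) * ln (2 ^ n * ?g) \<le> real (2 * M - 1) * ln (2 ^ n * ?f)"
      using f1 g1 by (simp only: ln_realpow)
    then show ?thesis
      using M unfolding \<eta>_def by (simp only: field_simps) (simp add: field_simps)
  qed
  ultimately show thesis
    by (rule that)
qed

section \<open>Noisy trajectories\<close>

abbreviation arr :: "complex mat \<Rightarrow> array" where
  "arr X \<equiv> \<lambda>i j. X $$ (i, j)"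

lemma dim_mat_adjoint [simp]: "dim_row (mat_adjoint A) = dim_col A" "dim_col (mat_adjoint A) = dim_row A"
  by (simp_all add: mat_adjoint_def)

lemma mat_adjoint_carrier [simp]: "A \<in> carrier_mat m n \<Longrightarrow> mat_adjoint A \<in> carrier_mat n m"
  by auto

lemma index_mat_adjoint:
  "i < dim_col A \<Longrightarrow> j < dim_row A \<Longrightarrow> mat_adjoint (A :: complex mat) $$ (i, j) = cnj (A $$ (j, i))"
  by (simp add: mat_adjoint_def mat_of_rows_index)

lemma index_mult_sum:
  "A \<in> carrier_mat l m \<Longrightarrow> B \<in> carrier_mat m n \<Longrightarrow> i < l \<Longrightarrow> j < n \<Longrightarrow>
    (A * B) $$ (i, j) = (\<Sum>k<m. A $$ (i, k) * B $$ (k, j))"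
  by (simp add: scalar_prod_def lessThan_atLeast0)

text \<open>Entries of products stay folded until \<open>index_mult_sum\<close> turns them into
  explicit sums, whose order can be exchanged.\<close>

declare index_mult_mat(1) [simp del]

lemma hs_norm_power2:
  assumes X: "X \<in> carrier_mat d d"
  shows "(hs_norm X)\<^sup>2 = frob2 d (arr X)"
proof -
  have "mat_trace (mat_adjoint X * X) = (\<Sum>i<d. \<Sum>j<d. cnj (X $$ (j, i)) * X $$ (j, i))"
    using X by (simp add: mat_trace_def index_mult_sum[OF mat_adjoint_carrier[OF X] X] index_mat_adjoint)
  also have "\<dots> = (\<Sum>j<d. \<Sum>i<d. cnj (X $$ (j, i)) * X $$ (j, i))"
    by (rule sum.swap)
  also have "\<dots> = frob_inner d (arr X) (arr X)"
    by (simp add: frob_inner_def mult.commute)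
  finally show ?thesis
    by (simp add: hs_norm_def frob_inner_self)
qed

lemma mat_trace_qubit_unit: "k < 2 \<Longrightarrow> l < 2 \<Longrightarrow> mat_trace (qubit_unit k l) = (if k = l then 1 else 0)"
  by (elim less_2E) (simp_all add: mat_trace_def qubit_unit_def sum_less_2)

lemma depolarizing_qubit_unit:
  assumes "k < 2" "l < 2" "i < 2" "j < 2"
  shows "depolarizing lam (qubit_unit k l) $$ (i, j) = depol_kernel (1 - lam) k l i j"
proof -
  have "depolarizing lam (qubit_unit k l) $$ (i, j)
      = complex_of_real (1 - lam) * (if i = k \<and> j = l then 1 else 0)
        + (complex_of_real lam * (if k = l then 1 else 0) / 2) * (if i = j then 1 else 0)"
    using assms by (simp add: depolarizing_def mat_trace_qubit_unit) (simp add: qubit_unit_def)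
  then show ?thesis
    by (auto simp: depol_kernel_def)
qed

lemma tensor_power_map_depolarizing:
  assumes "i < 2 ^ n" "j < 2 ^ n"
  shows "tensor_power_map (depolarizing lam) n X $$ (i, j) = noise (1 - lam) n (arr X) i j"
  using assms
  by (simp add: tensor_power_map_def noise_def noise_kernel_def depolarizing_qubit_unit)

lemma tensor_power_map_carrier [simp]: "tensor_power_map \<Phi> n X \<in> carrier_mat (2 ^ n) (2 ^ n)"
  by (simp add: tensor_power_map_def)

section \<open>Conjugation by isometries\<close>

definition isometric :: "nat \<Rightarrow> complex mat \<Rightarrow> bool" where
  "isometric d U \<longleftrightarrow> U \<in> carrier_mat d d \<and> mat_adjoint U * U = 1\<^sub>m d"

lemma isometric_carrier: "isometric d U \<Longrightarrow> U \<in> carrier_mat d d"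
  by (simp add: isometric_def)

lemma isometric_sum:
  assumes "isometric d U" "k < d" "l < d"
  shows "(\<Sum>i<d. cnj (U $$ (i, k)) * U $$ (i, l)) = (if k = l then 1 else 0)"
proof -
  have U: "U \<in> carrier_mat d d" and eq: "mat_adjoint U * U = 1\<^sub>m d"
    using assms(1) by (simp_all add: isometric_def)
  have "(mat_adjoint U * U) $$ (k, l) = (\<Sum>i<d. cnj (U $$ (i, k)) * U $$ (i, l))"
    using U assms(2,3) by (simp add: index_mult_sum[OF mat_adjoint_carrier[OF U] U] index_mat_adjoint)
  then show ?thesis
    using assms(2,3) by (simp add: eq)
qed

lemma isometric_norm:
  assumes "isometric d U"
  shows "(\<Sum>i<d. (cmod (\<Sum>k<d. U $$ (i, k) * x k))\<^sup>2) = (\<Sum>k<d. (cmod (x k))\<^sup>2)"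
proof -
  have "complex_of_real (\<Sum>i<d. (cmod (\<Sum>k<d. U $$ (i, k) * x k))\<^sup>2)
      = (\<Sum>i<d. \<Sum>l<d. \<Sum>k<d. (U $$ (i, l) * x l) * cnj (U $$ (i, k) * x k))"
    by (simp only: of_real_sum complex_norm_square cnj_sum sum_product)
  also have "\<dots> = (\<Sum>l<d. \<Sum>i<d. \<Sum>k<d. (U $$ (i, l) * x l) * cnj (U $$ (i, k) * x k))"
    by (rule sum.swap)
  also have "\<dots> = (\<Sum>l<d. \<Sum>k<d. \<Sum>i<d. (U $$ (i, l) * x l) * cnj (U $$ (i, k) * x k))"
    by (rule sum.cong[OF refl]) (rule sum.swap)
  also have "\<dots> = (\<Sum>l<d. \<Sum>k<d. (x l * cnj (x k)) * (\<Sum>i<d. cnj (U $$ (i, k)) * U $$ (i, l)))"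
    by (simp add: sum_distrib_left mult_ac)
  also have "\<dots> = (\<Sum>l<d. \<Sum>k<d. (x l * cnj (x k)) * (if k = l then 1 else 0))"
    using assms by (intro sum.cong refl) (simp add: isometric_sum)
  also have "\<dots> = (\<Sum>l<d. x l * cnj (x l))"
    by (simp add: if_distrib cong: if_cong)
  also have "\<dots> = complex_of_real (\<Sum>k<d. (cmod (x k))\<^sup>2)"
    by (simp only: of_real_sum complex_norm_square)
  finally show ?thesis
    by (simp only: of_real_eq_iff)
qed

lemma index_conjugation:
  assumes U: "U \<in> carrier_mat d d" and X: "X \<in> carrier_mat d d" and "i < d" "j < d"
  shows "(U * X * mat_adjoint U) $$ (i, j) = (\<Sum>k<d. \<Sum>l<d. U $$ (i, k) * X $$ (k, l) * cnj (U $$ (j, l)))"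
proof -
  have UX: "U * X \<in> carrier_mat d d" using U X by simp
  have "(U * X * mat_adjoint U) $$ (i, j) = (\<Sum>l<d. \<Sum>k<d. U $$ (i, k) * X $$ (k, l) * cnj (U $$ (j, l)))"
    using assms
    by (simp add: index_mult_sum[OF UX mat_adjoint_carrier[OF U]] index_mult_sum[OF U X]
        index_mat_adjoint sum_distrib_right)
  also have "\<dots> = (\<Sum>k<d. \<Sum>l<d. U $$ (i, k) * X $$ (k, l) * cnj (U $$ (j, l)))"
    by (rule sum.swap)
  finally show ?thesis .
qed

text \<open>Conjugation applies \<open>U\<close> to every column and, up to complex conjugation, to
  every row; \<open>isometric_norm\<close> removes each in turn.\<close>

lemma frob2_conjugation:
  assumes U: "isometric d U" and X: "X \<in> carrier_mat d d"
  shows "frob2 d (arr (U * X * mat_adjoint U)) = frob2 d (arr X)"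
proof -
  have "frob2 d (arr (U * X * mat_adjoint U))
      = (\<Sum>i<d. \<Sum>j<d. (cmod (\<Sum>k<d. U $$ (i, k) * (\<Sum>l<d. X $$ (k, l) * cnj (U $$ (j, l)))))\<^sup>2)"
    by (simp add: frob2_def index_conjugation[OF isometric_carrier[OF U] X] sum_distrib_left mult.assoc)
  also have "\<dots> = (\<Sum>j<d. \<Sum>i<d. (cmod (\<Sum>k<d. U $$ (i, k) * (\<Sum>l<d. X $$ (k, l) * cnj (U $$ (j, l)))))\<^sup>2)"
    by (rule sum.swap)
  also have "\<dots> = (\<Sum>j<d. \<Sum>k<d. (cmod (\<Sum>l<d. X $$ (k, l) * cnj (U $$ (j, l))))\<^sup>2)"
    by (simp only: isometric_norm[OF U])
  also have "\<dots> = (\<Sum>k<d. \<Sum>j<d. (cmod (\<Sum>l<d. X $$ (k, l) * cnj (U $$ (j, l))))\<^sup>2)"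
    by (rule sum.swap)
  also have "\<dots> = (\<Sum>k<d. \<Sum>j<d. (cmod (\<Sum>l<d. U $$ (j, l) * cnj (X $$ (k, l))))\<^sup>2)"
  proof (intro sum.cong refl)
    fix k j
    have "(\<Sum>l<d. X $$ (k, l) * cnj (U $$ (j, l))) = cnj (\<Sum>l<d. U $$ (j, l) * cnj (X $$ (k, l)))"
      by (simp add: mult.commute)
    then show "(cmod (\<Sum>l<d. X $$ (k, l) * cnj (U $$ (j, l))))\<^sup>2
        = (cmod (\<Sum>l<d. U $$ (j, l) * cnj (X $$ (k, l))))\<^sup>2"
      by (simp only: complex_mod_cnj)
  qed
  also have "\<dots> = frob2 d (arr X)"
    by (simp only: isometric_norm[OF U] frob2_def complex_mod_cnj)
  finally show ?thesis .
qed

lemma trace_conjugation: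
  assumes U: "isometric d U" and X: "X \<in> carrier_mat d d"
  shows "(\<Sum>i<d. (U * X * mat_adjoint U) $$ (i, i)) = (\<Sum>i<d. X $$ (i, i))"
proof -
  have "(\<Sum>i<d. (U * X * mat_adjoint U) $$ (i, i))
      = (\<Sum>i<d. \<Sum>k<d. \<Sum>l<d. U $$ (i, k) * X $$ (k, l) * cnj (U $$ (i, l)))"
    by (simp add: index_conjugation[OF isometric_carrier[OF U] X])
  also have "\<dots> = (\<Sum>k<d. \<Sum>i<d. \<Sum>l<d. U $$ (i, k) * X $$ (k, l) * cnj (U $$ (i, l)))"
    by (rule sum.swap)
  also have "\<dots> = (\<Sum>k<d. \<Sum>l<d. \<Sum>i<d. U $$ (i, k) * X $$ (k, l) * cnj (U $$ (i, l)))"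
    by (rule sum.cong[OF refl]) (rule sum.swap)
  also have "\<dots> = (\<Sum>k<d. \<Sum>l<d. X $$ (k, l) * (\<Sum>i<d. cnj (U $$ (i, l)) * U $$ (i, k)))"
    by (simp add: sum_distrib_left mult_ac)
  also have "\<dots> = (\<Sum>k<d. \<Sum>l<d. X $$ (k, l) * (if l = k then 1 else 0))"
    using U by (intro sum.cong refl) (simp add: isometric_sum)
  also have "\<dots> = (\<Sum>i<d. X $$ (i, i))"
    by (simp add: if_distrib cong: if_cong)
  finally show ?thesis .
qed

text \<open>The Gram factor B is replaced by U B.\<close>

lemma psd_conjugation:
  assumes U: "U \<in> carrier_mat d d" and X: "X \<in> carrier_mat d d" and psd: "psd d (arr X)"
  shows "psd d (arr (U * X * mat_adjoint U))"
proof -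
  obtain N :: nat and B where B: "\<And>i j. i < d \<Longrightarrow> j < d \<Longrightarrow> X $$ (i, j) = (\<Sum>m<N. B i m * cnj (B j m))"
    using psd unfolding psd_def by blast
  have "(U * X * mat_adjoint U) $$ (i, j)
      = (\<Sum>m<N. (\<Sum>k<d. U $$ (i, k) * B k m) * cnj (\<Sum>l<d. U $$ (j, l) * B l m))"
    if "i < d" "j < d" for i j
  proof -
    have "(U * X * mat_adjoint U) $$ (i, j)
        = (\<Sum>k<d. \<Sum>l<d. \<Sum>m<N. (U $$ (i, k) * B k m) * cnj (U $$ (j, l) * B l m))"
      using that by (simp add: index_conjugation[OF U X] B sum_distrib_left sum_distrib_right mult_ac)
    also have "\<dots> = (\<Sum>k<d. \<Sum>m<N. \<Sum>l<d. (U $$ (i, k) * B k m) * cnj (U $$ (j, l) * B l m))"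
      by (rule sum.cong[OF refl]) (rule sum.swap)
    also have "\<dots> = (\<Sum>m<N. \<Sum>k<d. \<Sum>l<d. (U $$ (i, k) * B k m) * cnj (U $$ (j, l) * B l m))"
      by (rule sum.swap)
    finally show ?thesis
      by (simp only: sum_product cnj_sum)
  qed
  then show ?thesis
    by (intro psdI[of "{..<N}" _ _ "\<lambda>i m. \<Sum>k<d. U $$ (i, k) * B k m"]) auto
qed

section \<open>Kronecker products and isometry of circuit layers\<close>

lemma dim_kron [simp]: "dim_row (kron A B) = dim_row A * dim_row B" "dim_col (kron A B) = dim_col A * dim_col B"
  by (simp_all add: kron_def)

lemma kron_carrier:
  "A \<in> carrier_mat a b \<Longrightarrow> B \<in> carrier_mat c d \<Longrightarrow> kron A B \<in> carrier_mat (a * c) (b * d)"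
  by (auto simp: kron_def)

lemma index_kron:
  "i < dim_row A * dim_row B \<Longrightarrow> j < dim_col A * dim_col B \<Longrightarrow>
    kron A B $$ (i, j) = A $$ (i div dim_row B, j div dim_col B) * B $$ (i mod dim_row B, j mod dim_col B)"
  by (simp add: kron_def)

lemma mod_less_of_less_mult: "i < a * b \<Longrightarrow> i mod b < b" for i a b :: nat
  by (cases "b = 0") simp_all

lemma mult_add_less:
  fixes p q b d :: nat
  assumes "p < b" "q < d"
  shows "p * d + q < b * d"
proof -
  have "p * d + q < Suc p * d" using assms(2) by simp
  also have "\<dots> \<le> b * d" using assms(1) by (intro mult_le_mono1) simp
  finally show ?thesis .
qed

text \<open>Mixed-product rule: the summation index p * d + q runs over all pairs (p, q), so the sum
  factors.\<close>

lemma kron_mult: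
  assumes A: "A \<in> carrier_mat a b" and B: "B \<in> carrier_mat c d"
    and C: "C \<in> carrier_mat b e" and D: "D \<in> carrier_mat d f"
  shows "kron A B * kron C D = kron (A * C) (B * D)"
proof (rule eq_matI)
  fix i j
  assume "i < dim_row (kron (A * C) (B * D))" "j < dim_col (kron (A * C) (B * D))"
  then have i: "i < a * c" and j: "j < e * f"
    using A B C D by simp_all
  have i': "i div c < a" "i mod c < c" and j': "j div f < e" "j mod f < f"
    using i j by (simp_all add: less_mult_imp_div_less mod_less_of_less_mult)
  have "(kron A B * kron C D) $$ (i, j) = (\<Sum>k<b * d. kron A B $$ (i, k) * kron C D $$ (k, j))"
    by (rule index_mult_sum[OF kron_carrier[OF A B] kron_carrier[OF C D] i j])
  also have "\<dots> = (\<Sum>p<b. \<Sum>q<d. kron A B $$ (i, p * d + q) * kron C D $$ (p * d + q, j))"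
    by (rule sum_lessThan_mult)
  also have "\<dots> = (\<Sum>p<b. \<Sum>q<d. (A $$ (i div c, p) * C $$ (p, j div f)) * (B $$ (i mod c, q) * D $$ (q, j mod f)))"
  proof (intro sum.cong refl)
    fix p q
    assume "p \<in> {..<b}" "q \<in> {..<d}"
    then have "p * d + q < b * d" "(p * d + q) div d = p" "(p * d + q) mod d = q"
      by (simp_all add: mult_add_less)
    then show "kron A B $$ (i, p * d + q) * kron C D $$ (p * d + q, j)
        = (A $$ (i div c, p) * C $$ (p, j div f)) * (B $$ (i mod c, q) * D $$ (q, j mod f))"
      using A B C D i j by (simp add: index_kron)
  qed
  also have "\<dots> = (\<Sum>p<b. A $$ (i div c, p) * C $$ (p, j div f)) * (\<Sum>q<d. B $$ (i mod c, q) * D $$ (q, j mod f))"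
    by (simp only: sum_product)
  also have "\<dots> = kron (A * C) (B * D) $$ (i, j)"
    using A B C D i j index_mult_sum[OF A C i'(1) j'(1)] index_mult_sum[OF B D i'(2) j'(2)]
    by (simp add: index_kron)
  finally show "(kron A B * kron C D) $$ (i, j) = kron (A * C) (B * D) $$ (i, j)" .
qed (use A B C D in simp_all)

lemma mat_adjoint_kron: "mat_adjoint (kron A B) = kron (mat_adjoint A) (mat_adjoint B)"
  by (rule eq_matI)
     (simp_all add: index_mat_adjoint index_kron less_mult_imp_div_less mod_less_of_less_mult)

lemma kron_one: "kron (1\<^sub>m a) (1\<^sub>m b) = 1\<^sub>m (a * b)"
proof (rule eq_matI)
  fix i j
  assume "i < dim_row (1\<^sub>m (a * b))" "j < dim_col (1\<^sub>m (a * b))"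
  then have ij: "i < a * b" "j < a * b" by simp_all
  have "i = j \<longleftrightarrow> i div b = j div b \<and> i mod b = j mod b"
    by (metis div_mult_mod_eq)
  then show "kron (1\<^sub>m a) (1\<^sub>m b) $$ (i, j) = 1\<^sub>m (a * b) $$ (i, j)"
    using ij by (simp add: index_kron less_mult_imp_div_less mod_less_of_less_mult)
qed simp_all

lemma isometric_one: "isometric d (1\<^sub>m d)"
proof -
  have "mat_adjoint (1\<^sub>m d :: complex mat) = 1\<^sub>m d"
    by (rule eq_matI) (auto simp: index_mat_adjoint)
  then show ?thesis
    by (simp add: isometric_def)
qed

lemma isometric_kron:
  assumes "isometric d A" "isometric e B"
  shows "isometric (d * e) (kron A B)"
  using assms unfolding isometric_def mat_adjoint_kron
  by (auto simp: kron_carrier kron_one kron_mult[of "mat_adjoint A" d d "mat_adjoint B" e e A d B e])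

lemma isometric_mult:
  assumes "isometric d A" "isometric d B"
  shows "isometric d (A * B)"
proof -
  have A: "A \<in> carrier_mat d d" and B: "B \<in> carrier_mat d d"
    using assms by (simp_all add: isometric_def)
  have eq: "mat_adjoint (A * B) = mat_adjoint B * mat_adjoint A"
  proof (rule eq_matI)
    fix i j
    assume "i < dim_row (mat_adjoint B * mat_adjoint A)" "j < dim_col (mat_adjoint B * mat_adjoint A)"
    then have ij: "i < d" "j < d" using A B by simp_all
    show "mat_adjoint (A * B) $$ (i, j) = (mat_adjoint B * mat_adjoint A) $$ (i, j)"
      using A B ij
      by (simp only: index_mult_sum[OF mat_adjoint_carrier[OF B] mat_adjoint_carrier[OF A] ij])
         (simp add: index_mat_adjoint index_mult_sum[OF A B] mult.commute)
  qed (use A B in simp_all)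
  have "mat_adjoint (A * B) * (A * B) = mat_adjoint B * (mat_adjoint A * (A * B))"
    unfolding eq using A B by (intro assoc_mult_mat) auto
  also have "mat_adjoint A * (A * B) = (mat_adjoint A * A) * B"
    using A B by (intro assoc_mult_mat[symmetric]) auto
  finally show ?thesis
    using assms by (simp add: isometric_def left_mult_one_mat[OF B] mult_carrier_mat[OF A B])
qed

lemma isometric_gate_op:
  assumes "local_gate kappa n g"
  shows "isometric (2 ^ n) (gate_op n g)"
proof -
  obtain a k G where g: "g = (a, k, G)" by (cases g)
  have G: "isometric (2 ^ k) G" and n: "a + k \<le> n"
    using assms by (simp_all add: g local_gate_def unitary_mat_def isometric_def)
  have "(2::nat) ^ a * (2 ^ k * 2 ^ (n - (a + k))) = 2 ^ n"
    using n by (simp flip: power_add)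
  then show ?thesis
    using isometric_kron[OF isometric_one isometric_kron[OF G isometric_one], of "2 ^ a" "2 ^ (n - (a + k))"]
    by (simp add: g gate_op_def)
qed

lemma isometric_local_layer:
  assumes "local_layer kappa n U"
  shows "isometric (2 ^ n) U"
proof -
  obtain gs where gs: "\<forall>g\<in>set gs. local_gate kappa n g" and U: "U = foldr (\<lambda>g M. gate_op n g * M) gs (1\<^sub>m (2 ^ n))"
    using assms unfolding local_layer_def by blast
  show ?thesis
    unfolding U using gs
    by (induction gs) (auto intro: isometric_one isometric_mult isometric_gate_op)
qed

section \<open>Invariants and purity of the trajectory\<close>

lemma kron_power_qubit_unit:
  "kron_power (qubit_unit 0 0) n = mat (2 ^ n) (2 ^ n) (\<lambda>(i, j). if i = 0 \<and> j = 0 then 1 else 0)"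
proof (induction n)
  case 0
  show ?case by (rule eq_matI) auto
next
  case (Suc n)
  have zero: "i = 0 \<longleftrightarrow> i div 2 ^ n = 0 \<and> i mod 2 ^ n = 0" for i :: nat
    by (metis div_mult_mod_eq add.right_neutral mult_zero_left div_0 mod_0)
  show ?case
    unfolding kron_power.simps Suc
  proof (rule eq_matI)
    fix i j
    assume "i < dim_row (mat (2 ^ Suc n) (2 ^ Suc n) (\<lambda>(i, j). if i = 0 \<and> j = 0 then 1 else 0 :: complex))"
      "j < dim_col (mat (2 ^ Suc n) (2 ^ Suc n) (\<lambda>(i, j). if i = 0 \<and> j = 0 then 1 else 0 :: complex))"
    then have ij: "i < 2 * 2 ^ n" "j < 2 * 2 ^ n" by simp_all
    then have "i div 2 ^ n < 2" "j div 2 ^ n < 2"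
      by (simp_all add: less_mult_imp_div_less)
    then have "kron (qubit_unit 0 0) (mat (2 ^ n) (2 ^ n) (\<lambda>(i, j). if i = 0 \<and> j = 0 then 1 else 0)) $$ (i, j)
        = (if i div 2 ^ n = 0 \<and> j div 2 ^ n = 0 then 1 else 0) * (if i mod 2 ^ n = 0 \<and> j mod 2 ^ n = 0 then 1 else 0)"
      using ij by (simp add: index_kron qubit_unit_def)
    also have "\<dots> = (if i = 0 \<and> j = 0 then 1 else 0)"
      using zero[of i] zero[of j] by auto
    finally show "kron (qubit_unit 0 0) (mat (2 ^ n) (2 ^ n) (\<lambda>(i, j). if i = 0 \<and> j = 0 then 1 else 0)) $$ (i, j)
        = mat (2 ^ Suc n) (2 ^ Suc n) (\<lambda>(i, j). if i = 0 \<and> j = 0 then 1 else 0) $$ (i, j)"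
      using ij by simp
  qed (simp_all add: qubit_unit_def)
qed

lemma trajectory_carrier [simp]: "trajectory lam n U l \<in> carrier_mat (2 ^ n) (2 ^ n)"
  by (cases l) (simp_all add: kron_power_qubit_unit)

text \<open>These invariants are the hypotheses of \<open>purity_decay\<close>; they hold initially
  and survive both conjugation and noise.\<close>

lemma trajectory_psd_trace:
  assumes lam: "0 \<le> lam" "lam \<le> 1" and U: "\<And>l. 1 \<le> l \<Longrightarrow> isometric (2 ^ n) (U l)"
  shows "psd (2 ^ n) (arr (trajectory lam n U l)) \<and> (\<Sum>i<2 ^ n. trajectory lam n U l $$ (i, i)) = 1"
proof (induction l)
  case 0
  have "psd (2 ^ n) (arr (trajectory lam n U 0))"
    by (rule psdI[of "{0::nat}" _ _ "\<lambda>i m. if i = 0 then 1 else 0"]) (auto simp: kron_power_qubit_unit)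
  moreover have "(\<Sum>i<2 ^ n. trajectory lam n U 0 $$ (i, i)) = (\<Sum>i<2 ^ n. if i = (0::nat) then 1 else 0)"
    by (intro sum.cong refl) (simp add: kron_power_qubit_unit)
  ultimately show ?case
    by simp
next
  case (Suc l)
  let ?\<rho> = "trajectory lam n U l" and ?\<sigma> = "U (Suc l) * trajectory lam n U l * mat_adjoint (U (Suc l))"
  have iso: "isometric (2 ^ n) (U (Suc l))" using U by simp
  have "psd (2 ^ n) (arr ?\<sigma>)"
    using Suc iso by (intro psd_conjugation) (simp_all add: isometric_def)
  then have "psd (2 ^ n) (noise (1 - lam) n (arr ?\<sigma>))"
    using lam by (intro psd_noise) simp_all
  then have "psd (2 ^ n) (arr (trajectory lam n U (Suc l)))"
    by (simp add: psd_def tensor_power_map_depolarizing)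
  moreover have "(\<Sum>i<2 ^ n. trajectory lam n U (Suc l) $$ (i, i)) = 1"
    using Suc by (simp add: tensor_power_map_depolarizing trace_noise trace_conjugation[OF iso])
  ultimately show ?case ..
qed

text \<open>The initial state is pure, so its normalised purity is 2^n. Conjugation preserves the
  purity and each layer of noise contributes a factor \<open>\<eta>\<close> to the bound on the
  logarithm, uniformly in \<open>n\<close> and the circuit.\<close>

lemma trajectory_purity_decay:
  assumes lam: "0 < lam" "lam \<le> 1"
  obtains \<eta> :: real where "0 < \<eta>" "\<eta> < 1"
    "\<And>n U l. (\<And>l. 1 \<le> l \<Longrightarrow> isometric (2 ^ n) (U l)) \<Longrightarrow>
       ln (2 ^ n * frob2 (2 ^ n) (arr (trajectory lam n U l))) \<le> \<eta> ^ l * (n * ln 2)"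
proof -
  obtain \<eta> :: real where \<eta>: "0 < \<eta>" "\<eta> < 1" and decay:
    "\<And>n X. psd (2 ^ n) X \<Longrightarrow> (\<Sum>i<2 ^ n. X i i) = 1 \<Longrightarrow>
       ln (2 ^ n * frob2 (2 ^ n) (noise (1 - lam) n X)) \<le> \<eta> * ln (2 ^ n * frob2 (2 ^ n) X)"
    using purity_decay[of "1 - lam"] lam by auto
  have "ln (2 ^ n * frob2 (2 ^ n) (arr (trajectory lam n U l))) \<le> \<eta> ^ l * (n * ln 2)"
    if U: "\<And>l. 1 \<le> l \<Longrightarrow> isometric (2 ^ n) (U l)" for n U l
  proof (induction l)
    case 0
    have "frob2 (2 ^ n) (arr (trajectory lam n U 0)) = frob2 (2 ^ n) (\<lambda>i j. if i = 0 \<and> j = 0 then 1 else 0)"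
      by (rule frob2_cong) (simp add: kron_power_qubit_unit)
    also have "\<dots> = (\<Sum>i<2 ^ n. \<Sum>j<2 ^ n. if i = (0::nat) then if j = (0::nat) then 1 else 0 else 0)"
      unfolding frob2_def by (intro sum.cong refl) auto
    also have "\<dots> = (\<Sum>i<2 ^ n. if i = (0::nat) then 1 else 0)"
      by (intro sum.cong refl) auto
    finally have "frob2 (2 ^ n) (arr (trajectory lam n U 0)) = 1" by simp
    then show ?case
      by (simp add: ln_realpow)
  next
    case (Suc l)
    let ?\<sigma> = "U (Suc l) * trajectory lam n U l * mat_adjoint (U (Suc l))"
    have iso: "isometric (2 ^ n) (U (Suc l))" using U by simp
    have pt: "psd (2 ^ n) (arr (trajectory lam n U l))" "(\<Sum>i<2 ^ n. trajectory lam n U l $$ (i, i)) = 1"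
      using trajectory_psd_trace[of lam n U l] lam U by auto
    have "frob2 (2 ^ n) (arr (trajectory lam n U (Suc l))) = frob2 (2 ^ n) (noise (1 - lam) n (arr ?\<sigma>))"
      by (rule frob2_cong) (simp add: tensor_power_map_depolarizing)
    then have "ln (2 ^ n * frob2 (2 ^ n) (arr (trajectory lam n U (Suc l))))
        \<le> \<eta> * ln (2 ^ n * frob2 (2 ^ n) (arr ?\<sigma>))"
      using pt iso by (simp only:) (intro decay psd_conjugation, auto simp: isometric_def trace_conjugation)
    also have "\<dots> = \<eta> * ln (2 ^ n * frob2 (2 ^ n) (arr (trajectory lam n U l)))"
      by (simp only: frob2_conjugation[OF iso trajectory_carrier])
    also have "\<dots> \<le> \<eta> * (\<eta> ^ l * (n * ln 2))"
      using Suc \<eta> by simp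
    finally show ?case
      by (simp add: mult.assoc)
  qed
  with \<eta> show thesis
    by (rule that)
qed

section \<open>Operator Schmidt rank across a cut\<close>

text \<open>An index has left part \<open>i div f\<close> and right part \<open>i mod f\<close>, so
  this is a sum of \<open>r\<close> Kronecker products written entrywise. It states an upper bound
  on the rank, which composes more easily than the minimum in \<open>bond_dim\<close>.\<close>

definition schmidt :: "nat \<Rightarrow> nat \<Rightarrow> complex mat \<Rightarrow> nat \<Rightarrow> bool" where
  "schmidt e f X r \<longleftrightarrow> (\<exists>A B. \<forall>i<e * f. \<forall>j<e * f.
     X $$ (i, j) = (\<Sum>\<alpha><r. A \<alpha> (i div f) (j div f) * B \<alpha> (i mod f) (j mod f)))"

lemma schmidtI:
  "(\<And>i j. i < e * f \<Longrightarrow> j < e * f \<Longrightarrow>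
     X $$ (i, j) = (\<Sum>\<alpha><r. A \<alpha> (i div f) (j div f) * B \<alpha> (i mod f) (j mod f))) \<Longrightarrow>
   schmidt e f X r"
  unfolding schmidt_def by blast

lemma schmidt_finiteI:
  assumes "finite S" and "\<And>i j. i < e * f \<Longrightarrow> j < e * f \<Longrightarrow>
     X $$ (i, j) = (\<Sum>s\<in>S. A s (i div f) (j div f) * B s (i mod f) (j mod f))"
  shows "schmidt e f X (card S)"
proof -
  obtain h where "bij_betw h {0..<card S} S"
    using ex_bij_betw_nat_finite[OF assms(1)] by blast
  then have h: "bij_betw h {..<card S} S"
    by (simp add: lessThan_atLeast0)
  have "X $$ (i, j) = (\<Sum>\<alpha><card S. A (h \<alpha>) (i div f) (j div f) * B (h \<alpha>) (i mod f) (j mod f))"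
    if "i < e * f" "j < e * f" for i j
    unfolding assms(2)[OF that] by (rule sum.reindex_bij_betw[OF h, symmetric])
  then show ?thesis
    by (rule schmidtI[where A = "\<lambda>\<alpha>. A (h \<alpha>)" and B = "\<lambda>\<alpha>. B (h \<alpha>)"])
qed

lemma schmidt_mono:
  assumes "schmidt e f X r" "r \<le> r'"
  shows "schmidt e f X r'"
proof -
  obtain A B where AB: "\<And>i j. i < e * f \<Longrightarrow> j < e * f \<Longrightarrow>
     X $$ (i, j) = (\<Sum>\<alpha><r. A \<alpha> (i div f) (j div f) * B \<alpha> (i mod f) (j mod f))"
    using assms(1) unfolding schmidt_def by blast
  have "X $$ (i, j) = (\<Sum>\<alpha><r'. (if \<alpha> < r then A \<alpha> else (\<lambda>_ _. 0)) (i div f) (j div f) * B \<alpha> (i mod f) (j mod f))"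
    if "i < e * f" "j < e * f" for i j
    unfolding AB[OF that] using assms(2) by (intro sum.mono_neutral_cong_left) auto
  then show ?thesis
    by (rule schmidtI[where A = "\<lambda>\<alpha>. if \<alpha> < r then A \<alpha> else (\<lambda>_ _. 0)" and B = B])
qed

text \<open>Pairs of terms index the product decomposition, since the inner summation index also
  splits at the cut.\<close>

lemma schmidt_mult:
  assumes X: "X \<in> carrier_mat (e * f) (e * f)" "schmidt e f X r"
    and Y: "Y \<in> carrier_mat (e * f) (e * f)" "schmidt e f Y s"
  shows "schmidt e f (X * Y) (r * s)"
proof -
  obtain A B where AB: "\<And>i j. i < e * f \<Longrightarrow> j < e * f \<Longrightarrow>
     X $$ (i, j) = (\<Sum>\<alpha><r. A \<alpha> (i div f) (j div f) * B \<alpha> (i mod f) (j mod f))"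
    using X(2) unfolding schmidt_def by blast
  obtain C D where CD: "\<And>i j. i < e * f \<Longrightarrow> j < e * f \<Longrightarrow>
     Y $$ (i, j) = (\<Sum>\<beta><s. C \<beta> (i div f) (j div f) * D \<beta> (i mod f) (j mod f))"
    using Y(2) unfolding schmidt_def by blast
  have "(X * Y) $$ (i, j) = (\<Sum>p\<in>{..<r} \<times> {..<s}.
      (\<Sum>u<e. A (fst p) (i div f) u * C (snd p) u (j div f)) * (\<Sum>v<f. B (fst p) (i mod f) v * D (snd p) v (j mod f)))"
    if ij: "i < e * f" "j < e * f" for i j
  proof -
    let ?t = "\<lambda>\<alpha> \<beta> u v. (A \<alpha> (i div f) u * C \<beta> u (j div f)) * (B \<alpha> (i mod f) v * D \<beta> v (j mod f))"
    have "(X * Y) $$ (i, j) = (\<Sum>u<e. \<Sum>v<f. X $$ (i, u * f + v) * Y $$ (u * f + v, j))"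
      unfolding index_mult_sum[OF X(1) Y(1) ij] by (rule sum_lessThan_mult)
    also have "\<dots> = (\<Sum>u<e. \<Sum>v<f. \<Sum>\<alpha><r. \<Sum>\<beta><s. ?t \<alpha> \<beta> u v)"
    proof (intro sum.cong refl)
      fix u v
      assume "u \<in> {..<e}" "v \<in> {..<f}"
      then have "u * f + v < e * f" "(u * f + v) div f = u" "(u * f + v) mod f = v"
        by (simp_all add: mult_add_less)
      then show "X $$ (i, u * f + v) * Y $$ (u * f + v, j) = (\<Sum>\<alpha><r. \<Sum>\<beta><s. ?t \<alpha> \<beta> u v)"
        using ij by (simp add: AB CD sum_product mult_ac)
    qed
    also have "\<dots> = (\<Sum>(u, v)\<in>{..<e} \<times> {..<f}. \<Sum>(\<alpha>, \<beta>)\<in>{..<r} \<times> {..<s}. ?t \<alpha> \<beta> u v)"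
      by (simp only: sum.cartesian_product[symmetric])
    also have "\<dots> = (\<Sum>(\<alpha>, \<beta>)\<in>{..<r} \<times> {..<s}. \<Sum>(u, v)\<in>{..<e} \<times> {..<f}. ?t \<alpha> \<beta> u v)"
      unfolding case_prod_unfold by (rule sum.swap)
    also have "\<dots> = (\<Sum>(\<alpha>, \<beta>)\<in>{..<r} \<times> {..<s}. \<Sum>u<e. \<Sum>v<f. ?t \<alpha> \<beta> u v)"
      by (simp only: sum.cartesian_product[symmetric])
    finally show ?thesis
      by (simp only: sum_product case_prod_unfold)
  qed
  then have "schmidt e f (X * Y) (card ({..<r} \<times> {..<s}))"
    by (intro schmidt_finiteI[where A = "\<lambda>p x y. \<Sum>u<e. A (fst p) x u * C (snd p) u y"
          and B = "\<lambda>p x y. \<Sum>v<f. B (fst p) x v * D (snd p) v y"]) auto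
  then show ?thesis
    by simp
qed

lemma schmidt_mat_adjoint:
  assumes X: "X \<in> carrier_mat (e * f) (e * f)" and "schmidt e f X r"
  shows "schmidt e f (mat_adjoint X) r"
proof -
  obtain A B where AB: "\<And>i j. i < e * f \<Longrightarrow> j < e * f \<Longrightarrow>
     X $$ (i, j) = (\<Sum>\<alpha><r. A \<alpha> (i div f) (j div f) * B \<alpha> (i mod f) (j mod f))"
    using assms(2) unfolding schmidt_def by blast
  then show ?thesis
    unfolding schmidt_def using X
    by (intro exI[of _ "\<lambda>\<alpha> x y. cnj (A \<alpha> y x)"] exI[of _ "\<lambda>\<alpha> x y. cnj (B \<alpha> y x)"])
       (simp add: index_mat_adjoint)
qed

lemma schmidt_kron:
  assumes "A \<in> carrier_mat e e" "B \<in> carrier_mat f f"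
  shows "schmidt e f (kron A B) 1"
  unfolding schmidt_def using assms
  by (intro exI[of _ "\<lambda>_. arr A"] exI[of _ "\<lambda>_. arr B"]) (simp add: index_kron)

lemma schmidt_one: "schmidt e f (1\<^sub>m (e * f)) 1"
  using schmidt_kron[of "1\<^sub>m e" e "1\<^sub>m f" f] by (simp add: kron_one)

text \<open>The left factors are the e * e matrix units, the right factors the corresponding blocks
  of X.\<close>

lemma schmidt_trivial: "schmidt e f X (e * e)"
proof -
  have "X $$ (i, j) = (\<Sum>p\<in>{..<e} \<times> {..<e}. (if p = (i div f, j div f) then 1 else 0) *
      X $$ (fst p * f + i mod f, snd p * f + j mod f))"
    if "i < e * f" "j < e * f" for i j
  proof -
    have "(i div f, j div f) \<in> {..<e} \<times> {..<e}"
      using that by (simp add: less_mult_imp_div_less)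
    then show ?thesis
      by (simp add: if_distrib[of "\<lambda>x. x * _"] cong: if_cong)
  qed
  then have "schmidt e f X (card ({..<e} \<times> {..<e}))"
    by (intro schmidt_finiteI[where A = "\<lambda>p x y. if p = (x, y) then 1 else 0"
          and B = "\<lambda>p x y. X $$ (fst p * f + x, snd p * f + y)"]) auto
  then show ?thesis
    by simp
qed

section \<open>Schmidt rank of gates and layers\<close>

lemma mod_mult_div: "m mod (e * d) div d = m div d mod e" for m d e :: nat
  by (cases "d = 0") (simp_all add: mult.commute[of e d] mod_mult2_eq)

text \<open>Each identity is absorbed by the factor on its own side of the cut, so padding a gate
  creates no new terms.\<close>

lemma schmidt_kron_kron:
  assumes X: "X \<in> carrier_mat (e * f) (e * f)" and "schmidt e f X r"
  shows "schmidt (p * e) (f * t) (kron (1\<^sub>m p) (kron X (1\<^sub>m t))) r"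
proof -
  obtain A B where AB: "\<And>i j. i < e * f \<Longrightarrow> j < e * f \<Longrightarrow>
     X $$ (i, j) = (\<Sum>\<alpha><r. A \<alpha> (i div f) (j div f) * B \<alpha> (i mod f) (j mod f))"
    using assms(2) unfolding schmidt_def by blast
  let ?A = "\<lambda>\<alpha> x y. (if x div e = y div e then 1 else 0) * A \<alpha> (x mod e) (y mod e)"
  let ?B = "\<lambda>\<alpha> x y. B \<alpha> (x div t) (y div t) * (if x mod t = y mod t then 1 else 0)"
  have "kron (1\<^sub>m p) (kron X (1\<^sub>m t)) $$ (i, j)
      = (\<Sum>\<alpha><r. ?A \<alpha> (i div (f * t)) (j div (f * t)) * ?B \<alpha> (i mod (f * t)) (j mod (f * t)))"
    if "i < p * e * (f * t)" "j < p * e * (f * t)" for i j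
  proof -
    \<comment> \<open>An index has four mixed-radix digits, with bases p, e, f, t. The cut groups
      them as (p, e) and (f, t), the nested Kronecker product as p, (e, f), t; these identities
      relate the two readings.\<close>
    have split: "i div (f * t) div e = i div (e * f * t)"
      "(i div (f * t)) mod e = i mod (e * f * t) div t div f"
      "i mod (f * t) div t = i mod (e * f * t) div t mod f"
      "i mod (f * t) mod t = i mod (e * f * t) mod t"
      "i div (e * f * t) < p" "i mod (e * f * t) < e * f * t"
      "i mod (e * f * t) div t < e * f" "i mod (e * f * t) mod t < t"
      if i: "i < p * e * (f * t)" for i
    proof -
      have i': "i < p * (e * f * t)" using i by (simp add: mult_ac)
      show "i div (f * t) div e = i div (e * f * t)"
        by (simp add: div_mult2_eq[symmetric] mult_ac)
      have "i mod (e * f * t) div (f * t) = i div (f * t) mod e"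
        using mod_mult_div[of i e "f * t"] by (simp only: mult.assoc)
      then show "(i div (f * t)) mod e = i mod (e * f * t) div t div f"
        by (simp add: div_mult2_eq[symmetric] mult.commute)
      have dvd: "i mod (e * f * t) mod (f * t) = i mod (f * t)"
        by (simp add: mod_mod_cancel mult.assoc)
      show "i mod (f * t) mod t = i mod (e * f * t) mod t"
        by (simp add: mod_mod_cancel)
      show "i mod (f * t) div t = i mod (e * f * t) div t mod f"
        unfolding mod_mult_div[symmetric] dvd ..
      show "i div (e * f * t) < p"
        using i' by (rule less_mult_imp_div_less)
      show lt: "i mod (e * f * t) < e * f * t"
        using i' by (rule mod_less_of_less_mult)
      show "i mod (e * f * t) div t < e * f"
        using lt by (rule less_mult_imp_div_less)
      show "i mod (e * f * t) mod t < t"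
        using lt by (rule mod_less_of_less_mult)
    qed
    note si = split[OF that(1)] and sj = split[OF that(2)]
    have "i < p * (e * f * t)" "j < p * (e * f * t)"
      using that by (simp_all add: mult_ac)
    then have "kron (1\<^sub>m p) (kron X (1\<^sub>m t)) $$ (i, j)
        = (if i div (e * f * t) = j div (e * f * t) then 1 else 0) *
          (X $$ (i mod (e * f * t) div t, j mod (e * f * t) div t) *
           (if i mod (e * f * t) mod t = j mod (e * f * t) mod t then 1 else 0))"
      using X si(5-8) sj(5-8) by (simp add: index_kron)
    also have "\<dots> = (\<Sum>\<alpha><r. ?A \<alpha> (i div (f * t)) (j div (f * t)) * ?B \<alpha> (i mod (f * t)) (j mod (f * t)))"
      unfolding si(1-4) sj(1-4) AB[OF si(7) sj(7)] sum_distrib_left sum_distrib_right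
      by (intro sum.cong refl) (simp add: mult_ac)
    finally show ?thesis .
  qed
  then show ?thesis
    by (rule schmidtI[where A = ?A and B = ?B])
qed

lemma kron_assoc: "kron (kron A B) C = kron A (kron B C)"
proof (rule eq_matI)
  fix i j
  assume "i < dim_row (kron A (kron B C))" "j < dim_col (kron A (kron B C))"
  then have i: "i < dim_row A * (dim_row B * dim_row C)" and j: "j < dim_col A * (dim_col B * dim_col C)"
    by simp_all
  have split: "k div c div b = k div (b * c)" "k div c mod b = k mod (b * c) div c"
    "k mod c = k mod (b * c) mod c" "k div c < a * b" "k mod (b * c) < b * c"
    if "k < a * (b * c)" for a b c k :: nat
  proof -
    show "k div c div b = k div (b * c)"
      by (simp add: div_mult2_eq[symmetric] mult.commute)
    show "k div c mod b = k mod (b * c) div c"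
      by (rule mod_mult_div[symmetric])
    show "k mod c = k mod (b * c) mod c"
      by (simp add: mod_mod_cancel)
    show "k div c < a * b"
      using that by (intro less_mult_imp_div_less) (simp add: mult.assoc)
    show "k mod (b * c) < b * c"
      using that by (rule mod_less_of_less_mult)
  qed
  show "kron (kron A B) C $$ (i, j) = kron A (kron B C) $$ (i, j)"
    using i j split[OF i] split[OF j] by (simp add: index_kron mult.assoc)
qed (simp_all add: mult.assoc)

text \<open>A gate on one side of the cut becomes a single Kronecker product after regrouping by
  associativity. A straddling gate has c - a < kappa qubits on the left, so
  \<open>schmidt_trivial\<close> gives at most 4^kappa terms.\<close>

lemma schmidt_gate_op:
  assumes g: "local_gate kappa n (a, k, G)" and c: "c \<le> n"
  shows "schmidt (2 ^ c) (2 ^ (n - c)) (gate_op n (a, k, G)) (if a < c \<and> c < a + k then 4 ^ kappa else 1)"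
proof -
  have G: "G \<in> carrier_mat (2 ^ k) (2 ^ k)" and k: "k \<le> kappa" and n: "a + k \<le> n"
    using g by (simp_all add: local_gate_def unitary_mat_def)
  let ?t = "n - (a + k)"
  have op: "gate_op n (a, k, G) = kron (1\<^sub>m (2 ^ a)) (kron G (1\<^sub>m (2 ^ ?t)))"
    by (simp add: gate_op_def)
  consider "c \<le> a" | "a + k \<le> c" | "a < c" "c < a + k" by linarith
  then show ?thesis
  proof cases
    case 1
    have "(2::nat) ^ a = 2 ^ c * 2 ^ (a - c)" "(2::nat) ^ (n - c) = 2 ^ (a - c) * (2 ^ k * 2 ^ ?t)"
      using 1 n by (simp_all flip: power_add)
    then have "schmidt (2 ^ c) (2 ^ (n - c)) (gate_op n (a, k, G)) 1"
      unfolding op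
      by (simp only: kron_one[symmetric] kron_assoc) (intro schmidt_kron kron_carrier one_carrier_mat G)
    then show ?thesis
      using 1 by simp
  next
    case 2
    have t: "(2::nat) ^ ?t = 2 ^ (c - (a + k)) * 2 ^ (n - c)" and "(2::nat) ^ c = 2 ^ a * (2 ^ k * 2 ^ (c - (a + k)))"
      using 2 n c by (simp_all flip: power_add)
    then have "schmidt (2 ^ c) (2 ^ (n - c))
        (kron (kron (1\<^sub>m (2 ^ a)) (kron G (1\<^sub>m (2 ^ (c - (a + k)))))) (1\<^sub>m (2 ^ (n - c)))) 1"
      by (simp only:) (intro schmidt_kron kron_carrier one_carrier_mat G)
    moreover have "gate_op n (a, k, G)
        = kron (kron (1\<^sub>m (2 ^ a)) (kron G (1\<^sub>m (2 ^ (c - (a + k)))))) (1\<^sub>m (2 ^ (n - c)))"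
      unfolding op t by (simp only: kron_one[symmetric] kron_assoc)
    ultimately show ?thesis
      using 2 by simp
  next
    case 3
    have e: "(2::nat) ^ c = 2 ^ a * 2 ^ (c - a)" "(2::nat) ^ (n - c) = 2 ^ (a + k - c) * 2 ^ ?t"
      and d: "(2::nat) ^ k = 2 ^ (c - a) * 2 ^ (a + k - c)"
      using 3 n c by (simp_all flip: power_add)
    have "schmidt (2 ^ c) (2 ^ (n - c)) (gate_op n (a, k, G)) (2 ^ (c - a) * 2 ^ (c - a))"
      unfolding op e using G by (intro schmidt_kron_kron schmidt_trivial) (simp add: d)
    moreover have "(2::nat) ^ (c - a) * 2 ^ (c - a) \<le> 4 ^ kappa"
    proof -
      have "(2::nat) ^ (c - a) * 2 ^ (c - a) = 4 ^ (c - a)"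
        by (simp flip: power_mult_distrib)
      also have "\<dots> \<le> 4 ^ kappa"
        using 3 k by (intro power_increasing) auto
      finally show ?thesis .
    qed
    ultimately show ?thesis
      using 3 by (auto intro: schmidt_mono)
  qed
qed

text \<open>Gates with disjoint supports cannot both contain the two qubits next to the cut.\<close>

lemma schmidt_local_layer:
  assumes U: "local_layer kappa n U" and c: "c \<le> n"
  shows "schmidt (2 ^ c) (2 ^ (n - c)) U (4 ^ kappa)"
proof -
  obtain gs where gs: "\<forall>g\<in>set gs. local_gate kappa n g"
      "sorted_wrt (\<lambda>g h. gate_support g \<inter> gate_support h = {}) gs"
    and U: "U = foldr (\<lambda>g M. gate_op n g * M) gs (1\<^sub>m (2 ^ n))"
    using U unfolding local_layer_def by blast
  define straddle where "straddle = (\<lambda>(a, k, G :: complex mat). a < c \<and> c < a + k)"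
  have n: "(2::nat) ^ n = 2 ^ c * 2 ^ (n - c)"
    using c by (simp flip: power_add)
  let ?M = "\<lambda>gs. foldr (\<lambda>g M. gate_op n g * M) gs (1\<^sub>m (2 ^ n))"
  \<comment> \<open>The claim records whether a straddling gate has occurred, so that 4^kappa enters
    at most once. The isometry part supplies the dimensions for \<open>schmidt_mult\<close>.\<close>
  have "isometric (2 ^ n) (?M gs) \<and>
      schmidt (2 ^ c) (2 ^ (n - c)) (?M gs) (if \<exists>g\<in>set gs. straddle g then 4 ^ kappa else 1)"
    using gs
  proof (induction gs)
    case Nil
    show ?case
      using schmidt_one[of "2 ^ c" "2 ^ (n - c)"] by (simp add: isometric_one n)
  next
    case (Cons g gs)
    have IH: "isometric (2 ^ n) (?M gs)"
        "schmidt (2 ^ c) (2 ^ (n - c)) (?M gs) (if \<exists>g\<in>set gs. straddle g then 4 ^ kappa else 1)"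
      using Cons by auto
    have g: "isometric (2 ^ n) (gate_op n g)"
      using Cons.prems by (auto intro: isometric_gate_op)
    have sg: "schmidt (2 ^ c) (2 ^ (n - c)) (gate_op n g) (if straddle g then 4 ^ kappa else 1)"
      using Cons.prems schmidt_gate_op[OF _ c] by (cases g) (simp add: straddle_def)
    \<comment> \<open>Qubit \<open>c\<close>, the first one to the right of the cut, lies in the
      support of every straddling gate.\<close>
    have disj: "\<not> straddle h" if "straddle g" "h \<in> set gs" for h
    proof
      assume "straddle h"
      then have "c \<in> gate_support g \<inter> gate_support h"
        using that(1) by (auto simp: straddle_def gate_support_def)
      then show False
        using Cons.prems(2) that(2) by auto
    qed
    have "schmidt (2 ^ c) (2 ^ (n - c)) (gate_op n g * ?M gs)
        ((if straddle g then 4 ^ kappa else 1) * (if \<exists>g\<in>set gs. straddle g then 4 ^ kappa else 1))"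
      using isometric_carrier[OF g] isometric_carrier[OF IH(1)]
      by (intro schmidt_mult sg IH(2)) (simp_all add: n[symmetric])
    then show ?case
      using isometric_mult[OF g IH(1)] disj by (auto split: if_splits)
  qed
  then show ?thesis
    unfolding U by (auto intro: schmidt_mono split: if_splits)
qed

section \<open>Schmidt rank under noise and along the trajectory\<close>

text \<open>Bits are numbered from the right, so the low \<open>m\<close> bits are the qubits right
  of the cut and the high \<open>c\<close> bits those left of it.\<close>

lemma noise_kernel_add:
  "noise_kernel r (m + c) k l i j =
    noise_kernel r c (k div 2 ^ m) (l div 2 ^ m) (i div 2 ^ m) (j div 2 ^ m) *
    noise_kernel r m (k mod 2 ^ m) (l mod 2 ^ m) (i mod 2 ^ m) (j mod 2 ^ m)"
proof -
  have low: "index_bit q (x mod 2 ^ m) = index_bit q x" if "q < m" for q x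
    using index_bit_add_mult_power[OF that, of "x div 2 ^ m" "x mod 2 ^ m"]
    by (simp only: div_mult_mod_eq)
  have high: "index_bit q (x div 2 ^ m) = index_bit (m + q) x" for q x
    by (simp add: index_bit_def power_add div_mult2_eq)
  have split: "(\<Prod>q<m + c. h q) = (\<Prod>q<c. h (m + q)) * (\<Prod>q<m. h q)" for h :: "nat \<Rightarrow> complex"
    by (induction c) (simp_all add: mult_ac)
  show ?thesis
    by (simp add: noise_kernel_def split low high)
qed

text \<open>The noise is a tensor product of maps on the two sides, hence acts on each term of a
  decomposition separately.\<close>

lemma schmidt_noise:
  assumes c: "c \<le> n" and X: "schmidt (2 ^ c) (2 ^ (n - c)) X r"
    and Y: "\<And>i j. i < 2 ^ n \<Longrightarrow> j < 2 ^ n \<Longrightarrow> Y $$ (i, j) = noise s n (arr X) i j"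
  shows "schmidt (2 ^ c) (2 ^ (n - c)) Y r"
proof -
  define m where "m = n - c"
  have n: "(2::nat) ^ n = 2 ^ c * 2 ^ m" and nm: "n = m + c"
    using c by (simp_all add: m_def flip: power_add)
  obtain A B where AB: "\<And>i j. i < 2 ^ c * 2 ^ m \<Longrightarrow> j < 2 ^ c * 2 ^ m \<Longrightarrow>
     X $$ (i, j) = (\<Sum>\<alpha><r. A \<alpha> (i div 2 ^ m) (j div 2 ^ m) * B \<alpha> (i mod 2 ^ m) (j mod 2 ^ m))"
    using X unfolding schmidt_def m_def[symmetric] by blast
  have "Y $$ (i, j) = (\<Sum>\<alpha><r. noise s c (A \<alpha>) (i div 2 ^ m) (j div 2 ^ m) * noise s m (B \<alpha>) (i mod 2 ^ m) (j mod 2 ^ m))"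
    if ij: "i < 2 ^ c * 2 ^ m" "j < 2 ^ c * 2 ^ m" for i j
  proof -
    let ?a = "\<lambda>\<alpha> a b. A \<alpha> a b * noise_kernel s c a b (i div 2 ^ m) (j div 2 ^ m)"
    let ?b = "\<lambda>\<alpha> k l. B \<alpha> k l * noise_kernel s m k l (i mod 2 ^ m) (j mod 2 ^ m)"
    let ?C = "{..<2 ^ c :: nat}" and ?M = "{..<2 ^ m :: nat}"
    have "Y $$ (i, j) = (\<Sum>a\<in>?C. \<Sum>k\<in>?M. \<Sum>b\<in>?C. \<Sum>l\<in>?M.
        X $$ (a * 2 ^ m + k, b * 2 ^ m + l) * noise_kernel s n (a * 2 ^ m + k) (b * 2 ^ m + l) i j)"
      using ij unfolding n[symmetric] by (simp only: Y) (simp only: noise_def n sum_lessThan_mult)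
    also have "\<dots> = (\<Sum>a\<in>?C. \<Sum>k\<in>?M. \<Sum>b\<in>?C. \<Sum>l\<in>?M. \<Sum>\<alpha><r. ?a \<alpha> a b * ?b \<alpha> k l)"
    proof (intro sum.cong refl)
      fix a k b l
      assume "a \<in> ?C" "k \<in> ?M" "b \<in> ?C" "l \<in> ?M"
      then have "a * 2 ^ m + k < 2 ^ c * 2 ^ m" "b * 2 ^ m + l < 2 ^ c * 2 ^ m" "k < 2 ^ m" "l < 2 ^ m"
        by (simp_all add: mult_add_less)
      then show "X $$ (a * 2 ^ m + k, b * 2 ^ m + l) * noise_kernel s n (a * 2 ^ m + k) (b * 2 ^ m + l) i j
          = (\<Sum>\<alpha><r. ?a \<alpha> a b * ?b \<alpha> k l)"
        by (simp add: AB nm noise_kernel_add sum_distrib_right mult_ac)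
    qed
    also have "\<dots> = (\<Sum>a\<in>?C. \<Sum>b\<in>?C. \<Sum>k\<in>?M. \<Sum>l\<in>?M. \<Sum>\<alpha><r. ?a \<alpha> a b * ?b \<alpha> k l)"
      by (rule sum.cong[OF refl]) (rule sum.swap)
    also have "\<dots> = (\<Sum>(a, b)\<in>?C \<times> ?C. \<Sum>(k, l)\<in>?M \<times> ?M. \<Sum>\<alpha><r. ?a \<alpha> a b * ?b \<alpha> k l)"
      by (simp only: sum.cartesian_product[symmetric])
    also have "\<dots> = (\<Sum>(a, b)\<in>?C \<times> ?C. \<Sum>\<alpha><r. \<Sum>(k, l)\<in>?M \<times> ?M. ?a \<alpha> a b * ?b \<alpha> k l)"
      unfolding case_prod_unfold by (rule sum.cong[OF refl]) (rule sum.swap)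
    also have "\<dots> = (\<Sum>\<alpha><r. \<Sum>(a, b)\<in>?C \<times> ?C. \<Sum>(k, l)\<in>?M \<times> ?M. ?a \<alpha> a b * ?b \<alpha> k l)"
      unfolding case_prod_unfold by (rule sum.swap)
    also have "\<dots> = (\<Sum>\<alpha><r. (\<Sum>(a, b)\<in>?C \<times> ?C. ?a \<alpha> a b) * (\<Sum>(k, l)\<in>?M \<times> ?M. ?b \<alpha> k l))"
      by (simp only: sum_product case_prod_unfold)
    also have "\<dots> = (\<Sum>\<alpha><r. noise s c (A \<alpha>) (i div 2 ^ m) (j div 2 ^ m) * noise s m (B \<alpha>) (i mod 2 ^ m) (j mod 2 ^ m))"
      by (simp only: noise_def sum.cartesian_product[symmetric])
    finally show ?thesis .
  qed
  then show ?thesis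
    unfolding m_def[symmetric]
    by (rule schmidtI[where A = "\<lambda>\<alpha>. noise s c (A \<alpha>)" and B = "\<lambda>\<alpha>. noise s m (B \<alpha>)"])
qed

lemma bond_dim_le:
  assumes c: "c \<le> n" and X: "X \<in> carrier_mat (2 ^ n) (2 ^ n)" and r: "schmidt (2 ^ c) (2 ^ (n - c)) X r"
  shows "bond_dim n c X \<le> r"
proof -
  have n: "(2::nat) ^ n = 2 ^ c * 2 ^ (n - c)"
    using c by (simp flip: power_add)
  obtain A B where AB: "\<And>i j. i < 2 ^ n \<Longrightarrow> j < 2 ^ n \<Longrightarrow>
     X $$ (i, j) = (\<Sum>\<alpha><r. A \<alpha> (i div 2 ^ (n - c)) (j div 2 ^ (n - c)) * B \<alpha> (i mod 2 ^ (n - c)) (j mod 2 ^ (n - c)))"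
    using r unfolding schmidt_def n by blast
  define XA where "XA \<alpha> = mat (2 ^ c) (2 ^ c) (\<lambda>(x, y). A \<alpha> x y)" for \<alpha>
  define XB where "XB \<alpha> = mat (2 ^ (n - c)) (2 ^ (n - c)) (\<lambda>(x, y). B \<alpha> x y)" for \<alpha>
  have "X = mat (2 ^ n) (2 ^ n) (\<lambda>(i, j). \<Sum>\<alpha><r. kron (XA \<alpha>) (XB \<alpha>) $$ (i, j))"
  proof (rule eq_matI)
    fix i j
    assume "i < dim_row (mat (2 ^ n) (2 ^ n) (\<lambda>(i, j). \<Sum>\<alpha><r. kron (XA \<alpha>) (XB \<alpha>) $$ (i, j)))"
      "j < dim_col (mat (2 ^ n) (2 ^ n) (\<lambda>(i, j). \<Sum>\<alpha><r. kron (XA \<alpha>) (XB \<alpha>) $$ (i, j)))"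
    then have ij: "i < 2 ^ n" "j < 2 ^ n" by simp_all
    then have ij': "i < 2 ^ c * 2 ^ (n - c)" "j < 2 ^ c * 2 ^ (n - c)" by (simp_all add: n)
    have "kron (XA \<alpha>) (XB \<alpha>) $$ (i, j)
        = A \<alpha> (i div 2 ^ (n - c)) (j div 2 ^ (n - c)) * B \<alpha> (i mod 2 ^ (n - c)) (j mod 2 ^ (n - c))" for \<alpha>
      using ij' by (simp add: index_kron XA_def XB_def less_mult_imp_div_less)
    then show "X $$ (i, j) = mat (2 ^ n) (2 ^ n) (\<lambda>(i, j). \<Sum>\<alpha><r. kron (XA \<alpha>) (XB \<alpha>) $$ (i, j)) $$ (i, j)"
      using ij by (simp add: AB)
  qed (use X in auto)
  then have "cut_decomposition n c X r"
    unfolding cut_decomposition_def by (intro exI[of _ XA] exI[of _ XB]) (simp add: XA_def XB_def)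
  then show ?thesis
    unfolding bond_dim_def by (rule Least_le)
qed

text \<open>The initial product state has one term. A layer costs 4^kappa for the unitary and again
  for its adjoint, and the noise adds nothing.\<close>

lemma schmidt_trajectory:
  assumes U: "\<And>l. 1 \<le> l \<Longrightarrow> local_layer kappa n (U l)" and c: "c \<le> n"
  shows "schmidt (2 ^ c) (2 ^ (n - c)) (trajectory lam n U l) (16 ^ (kappa * l))"
proof (induction l)
  case 0
  have n: "(2::nat) ^ n = 2 ^ c * 2 ^ (n - c)"
    using c by (simp flip: power_add)
  have zero: "i = 0 \<longleftrightarrow> i div 2 ^ (n - c) = 0 \<and> i mod 2 ^ (n - c) = 0" for i :: nat
    by (metis div_mult_mod_eq add.right_neutral mult_zero_left div_0 mod_0)
  have "kron_power (qubit_unit 0 0) n $$ (i, j) = (if i div 2 ^ (n - c) = 0 \<and> j div 2 ^ (n - c) = 0 then 1 else 0) *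
      (if i mod 2 ^ (n - c) = 0 \<and> j mod 2 ^ (n - c) = 0 then 1 else 0)"
    if "i < 2 ^ n" "j < 2 ^ n" for i j
    using that zero[of i] zero[of j] unfolding kron_power_qubit_unit by auto
  then show ?case
    unfolding schmidt_def n[symmetric]
    by (intro exI[of _ "\<lambda>_ x y. if x = 0 \<and> y = 0 then 1 else 0"]) auto
next
  case (Suc l)
  let ?V = "U (Suc l)" and ?\<rho> = "trajectory lam n U l"
  have n: "(2::nat) ^ n = 2 ^ c * 2 ^ (n - c)"
    using c by (simp flip: power_add)
  have V: "?V \<in> carrier_mat (2 ^ n) (2 ^ n)"
    using U[of "Suc l"] by (auto intro: isometric_carrier isometric_local_layer)
  have sV: "schmidt (2 ^ c) (2 ^ (n - c)) ?V (4 ^ kappa)"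
    using U[of "Suc l"] c by (intro schmidt_local_layer) simp_all
  have V': "?V \<in> carrier_mat (2 ^ c * 2 ^ (n - c)) (2 ^ c * 2 ^ (n - c))"
    and \<rho>': "?\<rho> \<in> carrier_mat (2 ^ c * 2 ^ (n - c)) (2 ^ c * 2 ^ (n - c))"
    using V trajectory_carrier[of lam n U l] by (simp_all only: n)
  have "schmidt (2 ^ c) (2 ^ (n - c)) (?V * ?\<rho> * mat_adjoint ?V) (4 ^ kappa * 16 ^ (kappa * l) * 4 ^ kappa)"
    by (rule schmidt_mult[OF mult_carrier_mat[OF V' \<rho>'] schmidt_mult[OF V' sV \<rho>' Suc]
          mat_adjoint_carrier[OF V'] schmidt_mat_adjoint[OF V' sV]])
  then have "schmidt (2 ^ c) (2 ^ (n - c)) (trajectory lam n U (Suc l)) (4 ^ kappa * 16 ^ (kappa * l) * 4 ^ kappa)"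
    by (rule schmidt_noise[OF c]) (simp add: tensor_power_map_depolarizing)
  moreover have "4 ^ kappa * 16 ^ (kappa * l) * 4 ^ kappa = (16 ^ (kappa * Suc l) :: nat)"
  proof -
    have "(4::nat) ^ kappa * 4 ^ kappa = 16 ^ kappa"
      by (simp flip: power_mult_distrib)
    then show ?thesis
      by (simp add: power_add mult_ac)
  qed
  ultimately show ?case
    by simp
qed

section \<open>The maximally mixed state as approximation\<close>

definition maximally_mixed :: "nat \<Rightarrow> complex mat" where
  "maximally_mixed n = mat (2 ^ n) (2 ^ n) (\<lambda>(i, j). if i = j then 1 / 2 ^ n else 0)"

lemma schmidt_maximally_mixed:
  assumes "c \<le> n"
  shows "schmidt (2 ^ c) (2 ^ (n - c)) (maximally_mixed n) 1"
proof (rule schmidtI[where A = "\<lambda>_ x y. if x = y then 1 else 0" and B = "\<lambda>_ x y. if x = y then 1 / 2 ^ n else 0"])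
  fix i j :: nat
  assume ij: "i < 2 ^ c * 2 ^ (n - c)" "j < 2 ^ c * 2 ^ (n - c)"
  have n: "(2::nat) ^ n = 2 ^ c * 2 ^ (n - c)"
    using assms by (simp flip: power_add)
  have "i = j \<longleftrightarrow> i div 2 ^ (n - c) = j div 2 ^ (n - c) \<and> i mod 2 ^ (n - c) = j mod 2 ^ (n - c)"
    by (metis div_mult_mod_eq)
  then show "maximally_mixed n $$ (i, j) = (\<Sum>\<alpha><(1::nat).
      (if i div 2 ^ (n - c) = j div 2 ^ (n - c) then 1 else 0) *
      (if i mod 2 ^ (n - c) = j mod 2 ^ (n - c) then 1 / 2 ^ n else 0))"
    using ij unfolding n[symmetric] maximally_mixed_def by auto
qed

lemma hs_norm_diff_maximally_mixed:
  assumes X: "X \<in> carrier_mat (2 ^ n) (2 ^ n)" and tr: "(\<Sum>i<2 ^ n. X $$ (i, i)) = 1"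
  shows "(hs_norm (X - maximally_mixed n))\<^sup>2 = (hs_norm X)\<^sup>2 - 1 / 2 ^ n"
proof -
  have mm: "maximally_mixed n \<in> carrier_mat (2 ^ n) (2 ^ n)"
    by (simp add: maximally_mixed_def)
  have "(hs_norm (X - maximally_mixed n))\<^sup>2 = frob2 (2 ^ n) (arr (X - maximally_mixed n))"
    using mm by (intro hs_norm_power2) (rule minus_carrier_mat)
  also have "\<dots> = frob2 (2 ^ n) (\<lambda>i j. X $$ (i, j) - (if i = j then 1 / 2 ^ n else 0))"
    using X by (intro frob2_cong) (simp add: maximally_mixed_def)
  finally show ?thesis
    by (simp only: frob2_diff_maximally_mixed[where X = "arr X", OF tr] hs_norm_power2[OF X])
qed

section \<open>Choice of the cutoff depth and the resulting polynomial\<close>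

text \<open>The polynomial is chosen before \<open>n\<close>, the circuit, the cut and the depth, so
  it depends only on \<open>lam\<close>, \<open>eps\<close> and \<open>kappa\<close>.\<close>

theorem proposition1:
  fixes lam eps :: real and kappa :: nat
  assumes "0 < lam" and "lam < 1" and "0 < eps" and "eps < 1"
  shows "\<exists>p :: nat poly. \<forall>n \<ge> 1. \<forall>U :: nat \<Rightarrow> complex mat. (\<forall>l \<ge> 1. local_layer kappa n (U l)) \<longrightarrow>
    (\<forall>c \<le> n. \<exists>rho_hat :: nat \<Rightarrow> complex mat. \<forall>l.
       rho_hat l \<in> carrier_mat (2 ^ n) (2 ^ n) \<and>
       bond_dim n c (rho_hat l) \<le> poly p n \<and>
       (hs_norm (trajectory lam n U l - rho_hat l))\<^sup>2 \<le> eps * (hs_norm (trajectory lam n U l))\<^sup>2 \<and>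
       (hs_norm (trajectory lam n U l))\<^sup>2 \<le> 1 \<and>
       (hs_norm (trajectory lam n U l - rho_hat l))\<^sup>2 \<le> eps)"
proof -
  obtain \<eta> :: real where \<eta>: "0 < \<eta>" "\<eta> < 1" and decay:
    "\<And>n U l. (\<And>l. 1 \<le> l \<Longrightarrow> isometric (2 ^ n) (U l)) \<Longrightarrow>
       ln (2 ^ n * frob2 (2 ^ n) (arr (trajectory lam n U l))) \<le> \<eta> ^ l * (n * ln 2)"
    using trajectory_purity_decay[of lam] assms by auto
  \<comment> \<open>Every \<open>t\<close> layers at least halve the bound on the logarithm of the
    normalised purity; \<open>t0\<close> further layers bring it from ln 2 down to ln (1 +
    eps).\<close>
  obtain t where t: "\<eta> ^ t < 1 / 2"
    using real_arch_pow_inv[of "1 / 2" \<eta>] \<eta> by auto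
  obtain t0 where "\<eta> ^ t0 < ln (1 + eps) / ln 2"
    using real_arch_pow_inv[of "ln (1 + eps) / ln 2" \<eta>] \<eta> assms by auto
  then have t0: "\<eta> ^ t0 * ln 2 \<le> ln (1 + eps)"
    by (simp add: field_simps)
  \<comment> \<open>This monomial is 16^(kappa t0) (2 n)^(4 kappa t), a bound for 16^(kappa L) at
    the cutoff depth \<open>L\<close> below.\<close>
  define p :: "nat poly" where "p = monom (16 ^ (kappa * t0) * 2 ^ (4 * kappa * t)) (4 * kappa * t)"
  have main: "\<exists>rho_hat :: nat \<Rightarrow> complex mat. \<forall>l.
       rho_hat l \<in> carrier_mat (2 ^ n) (2 ^ n) \<and>
       bond_dim n c (rho_hat l) \<le> poly p n \<and>
       (hs_norm (trajectory lam n U l - rho_hat l))\<^sup>2 \<le> eps * (hs_norm (trajectory lam n U l))\<^sup>2 \<and>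
       (hs_norm (trajectory lam n U l))\<^sup>2 \<le> 1 \<and>
       (hs_norm (trajectory lam n U l - rho_hat l))\<^sup>2 \<le> eps"
    if n: "1 \<le> n" and U: "\<forall>l \<ge> 1. local_layer kappa n (U l)" and c: "c \<le> n" for n U c
  proof -
    let ?\<rho> = "trajectory lam n U"
    define P where "P l = frob2 (2 ^ n) (arr (?\<rho> l))" for l
    have iso: "isometric (2 ^ n) (U l)" if "1 \<le> l" for l
      using U that isometric_local_layer by blast
    have tr: "(\<Sum>i<2 ^ n. ?\<rho> l $$ (i, i)) = 1" for l
      using trajectory_psd_trace[of lam n U l] iso assms by simp
    have P1: "1 \<le> 2 ^ n * P l" for l
      unfolding P_def using tr by (rule one_le_frob2)
    have hs: "(hs_norm (?\<rho> l))\<^sup>2 = P l" for l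
      unfolding P_def by (rule hs_norm_power2) simp
    have lnP: "ln (2 ^ n * P l) \<le> \<eta> ^ l * (n * ln 2)" for l
      unfolding P_def using iso by (rule decay)
    \<comment> \<open>The logarithmic decay bound already implies this, because powers of
      \<open>\<eta>\<close> are at most 1.\<close>
    have P_le: "P l \<le> 1" for l
    proof -
      have "\<eta> ^ l * (n * ln 2) \<le> 1 * (n * ln 2)"
        using \<eta> by (intro mult_right_mono power_le_one) simp_all
      then have "ln (2 ^ n * P l) \<le> ln (2 ^ n)"
        using lnP[of l] by (simp add: ln_realpow)
      then have "2 ^ n * P l \<le> 2 ^ n"
        using P1[of l] by (subst (asm) ln_le_cancel_iff) auto
      then show ?thesis by simp
    qed
    \<comment> \<open>Rounding up to a power of two gives 2^b between n and 2 n, so \<open>b\<close>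
      is a logarithmic number of halvings.\<close>
    obtain m where m: "2 ^ m \<le> n" "n < 2 ^ (m + 1)"
      using ex_power_ivl1[of 2 n] n by auto
    define b where "b = m + 1"
    have b: "n \<le> 2 ^ b" "2 ^ b \<le> 2 * n"
      using m by (simp_all add: b_def)
    define L where "L = t0 + t * b"
    \<comment> \<open>Before the cutoff the state itself has small enough rank; from the cutoff on
      it is close enough to maximally mixed.\<close>
    define rho_hat where "rho_hat l = (if l < L then ?\<rho> l else maximally_mixed n)" for l
    have late: "2 ^ n * P l \<le> 1 + eps" if "L \<le> l" for l
    proof -
      have "\<eta> ^ l \<le> \<eta> ^ L"
        using \<eta> that by (intro power_decreasing) simp_all
      also have "\<dots> = \<eta> ^ t0 * (\<eta> ^ t) ^ b"
        by (simp add: L_def power_add power_mult)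
      also have "\<dots> \<le> \<eta> ^ t0 * (1 / 2) ^ b"
        using \<eta> t by (intro mult_left_mono power_mono) simp_all
      finally have "\<eta> ^ l * (n * ln 2) \<le> \<eta> ^ t0 * (1 / 2) ^ b * (n * ln 2)"
        by (rule mult_right_mono) simp
      also have "\<dots> \<le> \<eta> ^ t0 * (1 / 2) ^ b * (2 ^ b * ln 2)"
      proof (intro mult_left_mono mult_right_mono)
        have "real n \<le> real (2 ^ b)"
          using b(1) by (simp only: of_nat_le_iff)
        then show "real n \<le> 2 ^ b" by simp
      qed (use \<eta> in simp_all)
      also have "\<dots> = \<eta> ^ t0 * ln 2"
        by (simp add: power_divide)
      finally have "ln (2 ^ n * P l) \<le> ln (1 + eps)"
        using lnP[of l] t0 by linarith
      then show ?thesis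
        using P1[of l] assms(3) by (subst (asm) ln_le_cancel_iff) auto
    qed
    have rank: "bond_dim n c (rho_hat l) \<le> poly p n" for l
    proof (cases "l < L")
      case True
      have "bond_dim n c (rho_hat l) \<le> 16 ^ (kappa * l)"
        using True U c unfolding rho_hat_def
        by (simp only: if_True) (intro bond_dim_le schmidt_trajectory, simp_all)
      also have "\<dots> \<le> 16 ^ (kappa * L)"
        using True by (intro power_increasing) simp_all
      also have "\<dots> = 16 ^ (kappa * t0) * (2 ^ b) ^ (4 * kappa * t)"
      proof -
        \<comment> \<open>Writing 16 as 2^4 exposes the factor 2^b, through which the bound becomes
          polynomial in n.\<close>
        have "(16::nat) ^ (kappa * (t * b)) = (2 ^ 4) ^ (kappa * (t * b))"
          by simp
        also have "\<dots> = (2 ^ b) ^ (4 * kappa * t)"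
          unfolding power_mult[symmetric] by (simp add: mult_ac)
        finally show ?thesis
          by (simp add: L_def distrib_left power_add)
      qed
      also have "\<dots> \<le> 16 ^ (kappa * t0) * (2 * n) ^ (4 * kappa * t)"
        using b(2) by (intro mult_left_mono power_mono) simp_all
      also have "\<dots> = poly p n"
        by (simp add: p_def poly_monom power_mult_distrib)
      finally show ?thesis .
    next
      case False
      have "bond_dim n c (rho_hat l) \<le> 1"
        using False c unfolding rho_hat_def
        by (simp only: if_False) (intro bond_dim_le schmidt_maximally_mixed, simp_all add: maximally_mixed_def)
      also have "1 \<le> poly p n"
        using n by (simp add: p_def poly_monom Suc_le_eq)
      finally show ?thesis .
    qed
    have err: "(hs_norm (?\<rho> l - rho_hat l))\<^sup>2 \<le> eps * P l" for l
    proof (cases "l < L")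
      case True
      have "(hs_norm (?\<rho> l - ?\<rho> l))\<^sup>2 = frob2 (2 ^ n) (arr (?\<rho> l - ?\<rho> l))"
        by (rule hs_norm_power2) (simp add: minus_carrier_mat)
      also have "\<dots> = frob2 (2 ^ n) (\<lambda>i j. 0)"
        by (intro frob2_cong) (simp add: carrier_matD[OF trajectory_carrier])
      finally show ?thesis
        using True assms(3) by (simp add: rho_hat_def frob2_def P_def[symmetric])
          (simp add: P_def)
    next
      case False
      have "(hs_norm (?\<rho> l - rho_hat l))\<^sup>2 = P l - 1 / 2 ^ n"
        using False by (simp add: rho_hat_def hs_norm_diff_maximally_mixed tr hs)
      also have "\<dots> \<le> eps * (1 / 2 ^ n)"
      proof -
        have "P l \<le> (1 + eps) / 2 ^ n"
          using late[of l] False by (simp add: field_simps)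
        then show ?thesis
          by (simp add: add_divide_distrib)
      qed
      \<comment> \<open>The absolute error becomes a relative one because the purity is never below
        1/2^n.\<close>
      also have "\<dots> \<le> eps * P l"
        using P1[of l] assms(3) by (intro mult_left_mono) (simp_all add: field_simps)
      finally show ?thesis .
    qed
    have err': "(hs_norm (?\<rho> l - rho_hat l))\<^sup>2 \<le> eps" for l
    proof -
      have "eps * P l \<le> eps * 1"
        using P_le assms(3) by (intro mult_left_mono) simp_all
      then show ?thesis
        using err[of l] by linarith
    qed
    have "rho_hat l \<in> carrier_mat (2 ^ n) (2 ^ n)" for l
      by (simp add: rho_hat_def maximally_mixed_def)
    then show ?thesis
      using rank err err' P_le by (intro exI[of _ rho_hat]) (simp add: hs)
  qed
  show ?thesis
    by (intro exI[of _ p] allI impI) (rule main)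
qed

end
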